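(* For each $q\in\mathcal M$, the polynomial $\psi(q)\in\mathbb C[x,y]$ is invariant under the (birational) actions of $W$ and $\tilde W$, i.e. $\psi(w(q))=\psi(q)$ for each $w\in W\times\tilde W$ and each $q$ at which $w$ is defined. In particular, the coefficients of $f(x,y)=\psi(q)$ are conserved quantities for $W\times\tilde W$.
   Context: Fix integers $n\ge2$, $m\ge1$, $1\le k\le n$; $N=\gcd(n,k)$, $n'=n/N$. Let $\mathcal M=\mathbb C^{mn}$ with coordinates $q=(q_{ij})_{1\le i\le m,\,1\le j\le n}$. Let $Q_i(x)$ be the $n\times n$ matrix with diagonal entries $q_{i1},\dots,q_{in}$, entries $1$ in positions $(j+1,j)$ for $1\le j\le n-1$, entry $x$ in position $(1,n)$, and zeros elsewhere; let $P(x)$ be the same matrix with zero diagonal. Define $\psi(q)=\det\big(Q_1(x)\cdots Q_m(x)P(x)^k-y\big)\in\mathbb C[x,y]$. Geometric $R$-matrix. For $\mathbf a=(a_1,\dots,a_L)$ put $\mathbf a^{(i)}=(a_{i+1},\dots,a_L,a_1,\dots,a_i)$. Let $E(\mathbf a,\mathbf b)=\sum_{i=0}^{L-1}\left(\prod_{j=1}^{i}b_j\prod_{j=i+2}^{L}a_j\right)$ and $R(\mathbf a,\mathbf b)=(\mathbf b',\mathbf a')$ with $b_i'=b_i\,E(\mathbf a^{(i)},\mathbf b^{(i)})/E(\mathbf a^{(i-1)},\mathbf b^{(i-1)})$, $a_i'=a_i\,E(\mathbf a^{(i-1)},\mathbf b^{(i-1)})/E(\mathbf a^{(i)},\mathbf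 b^{(i)})$. Actions. Extend $q_{ij}$ to $(i,j)\in\mathbb Z^2$ by $q_{i,j+n}=q_{i,j}$ and $q_{i+m,j}=q_{i,j-k}$. For $1\le r\le m-1$, $s_r$ replaces the pair of vectors $\big((q_{r,j})_{j\in[n]},(q_{r+1,j})_{j\in[n]}\big)$ by its image under $R$ and fixes the other $q_{ij}$; $\pi(q)_{ij}=q_{i+1,j}$. Put $\tilde q_{r,l}=q_{m+1-l,\,N+1-r}$ for $1\le r\le N$, $1\le l\le mn'$ (these are all the coordinates, each once). For $1\le r\le N-1$, $\tilde s_r$ replaces the pair $\big((\tilde q_{r,l})_l,(\tilde q_{r+1,l})_l\big)$ by its image under $R$ and fixes the other coordinates; $\tilde\pi(q)_{ij}=q_{i,j-1}$. $W$ is the (extended affine symmetric) group of birational maps generated by $s_1,\dots,s_{m-1},\pi$, and $\tilde W$ the one generated by $\tilde s_1,\dots,\tilde s_{N-1},\tilde\pi$; the two actions commute. *)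

theory Defs
  imports
    "Jordan_Normal_Form.Determinant"
    "HOL-Algebra.Generated_Groups"
    "HOL-Library.FuncSet"
begin

text \<open>Phase space: the points \<open>q = (q\<^sub>i\<^sub>j)\<close> with \<open>1 \<le> i \<le> m\<close> and \<open>1 \<le> j \<le> n\<close>.\<close>

type_synonym point = "nat \<times> nat \<Rightarrow> complex"

definition block :: "nat \<Rightarrow> nat \<Rightarrow> (nat \<times> nat) set" where
  "block m n = {1..m} \<times> {1..n}"

definition phase_space :: "nat \<Rightarrow> nat \<Rightarrow> point set" where
  "phase_space m n = (block m n \<rightarrow>\<^sub>E UNIV)"

text \<open>
  The extension of \<open>q\<close> to \<open>\<int> \<times> \<int>\<close> with \<open>q\<^sub>i\<^sub>,\<^sub>j\<^sub>+\<^sub>n = q\<^sub>i\<^sub>,\<^sub>j\<close> and \<open>q\<^sub>i\<^sub>+\<^sub>m\<^sub>,\<^sub>j = q\<^sub>i\<^sub>,\<^sub>j\<^sub>-\<^sub>k\<close>: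
  first the row is brought into \<open>{1..m}\<close>, which shifts the column by a multiple of \<open>k\<close>,
  then the column is brought into \<open>{1..n}\<close>.  The next three lemmas characterise it.
\<close>

definition ext :: "nat \<Rightarrow> nat \<Rightarrow> nat \<Rightarrow> point \<Rightarrow> int \<Rightarrow> int \<Rightarrow> complex" where
  "ext m n k q i j =
     q (nat ((i - 1) mod int m + 1),
        nat ((j - int k * ((i - 1) div int m) - 1) mod int n + 1))"

lemma ext_block:
  assumes "i \<in> {1..m}" "j \<in> {1..n}"
  shows "ext m n k q (int i) (int j) = q (i, j)"
proof -
  have i: "(int i - 1) mod int m = int i - 1" "(int i - 1) div int m = 0"
    using assms by auto
  have j: "(int j - 1) mod int n = int j - 1"
    using assms by auto
  show ?thesis by (simp add: ext_def i j)
qed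

lemma ext_column_period: "ext m n k q i (j + int n) = ext m n k q i j"
proof -
  have "(j + int n - c - 1) mod int n = (j - c - 1) mod int n" for c
    by (metis add_diff_eq diff_add_eq mod_add_self2 diff_diff_eq)
  then show ?thesis by (simp add: ext_def)
qed

lemma ext_row_period:
  assumes "m \<ge> 1"
  shows "ext m n k q (i + int m) j = ext m n k q i (j - int k)"
proof -
  have 1: "(i + int m - 1) mod int m = (i - 1) mod int m"
    by (metis add_diff_eq diff_add_eq mod_add_self2)
  have 2: "(i + int m - 1) div int m = (i - 1) div int m + 1"
    using assms div_add_self2[of "int m" "i - 1"] by (simp add: algebra_simps)
  show ?thesis by (simp add: ext_def 1 2 algebra_simps)
qed


text \<open>
  \<open>\<complex>[x,y]\<close> is rendered as \<open>complex poly poly\<close>, that is \<open>\<complex>[x][y]\<close>.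
  Matrix indices start at 0 in this library, the coordinates of \<open>q\<close> at 1.
\<close>

abbreviation var_x :: "complex poly poly" where
  "var_x \<equiv> [:[:0, 1:]:]"

abbreviation var_y :: "complex poly poly" where
  "var_y \<equiv> [:0, 1:]"

definition lax_mat :: "nat \<Rightarrow> (nat \<Rightarrow> complex) \<Rightarrow> complex poly poly mat" where
  "lax_mat n d = Matrix.mat n n (\<lambda>(i, j).
     if i = j then [:[:d (i + 1):]:]
     else if i = j + 1 then 1
     else if i = 0 \<and> j = n - 1 then var_x
     else 0)"

definition Q_mat :: "nat \<Rightarrow> point \<Rightarrow> nat \<Rightarrow> complex poly poly mat" where
  "Q_mat n q i = lax_mat n (\<lambda>j. q (i, j))"

definition P_mat :: "nat \<Rightarrow> complex poly poly mat" where
  "P_mat n = lax_mat n (\<lambda>j. 0)"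

definition psi :: "nat \<Rightarrow> nat \<Rightarrow> nat \<Rightarrow> point \<Rightarrow> complex poly poly" where
  "psi m n k q =
     det (foldr (\<lambda>i A. Q_mat n q i * A) [1..<m + 1] (1\<^sub>m n) * (P_mat n ^\<^sub>m k)
          - var_y \<cdot>\<^sub>m 1\<^sub>m n)"


text \<open>
  The geometric R-matrix on vectors \<open>(a\<^sub>1, \<dots>, a\<^sub>L)\<close>, given as functions of which only the
  values on \<open>{1..L}\<close> matter.
\<close>

definition rot :: "nat \<Rightarrow> nat \<Rightarrow> (nat \<Rightarrow> complex) \<Rightarrow> nat \<Rightarrow> complex" where
  "rot L i a = (\<lambda>j. a ((i + j - 1) mod L + 1))"

definition geom_E :: "nat \<Rightarrow> (nat \<Rightarrow> complex) \<Rightarrow> (nat \<Rightarrow> complex) \<Rightarrow> complex" where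
  "geom_E L a b = (\<Sum>i<L. (\<Prod>j=1..i. b j) * (\<Prod>j=i+2..L. a j))"

definition rot_E :: "nat \<Rightarrow> (nat \<Rightarrow> complex) \<Rightarrow> (nat \<Rightarrow> complex) \<Rightarrow> nat \<Rightarrow> complex" where
  "rot_E L a b i = geom_E L (rot L i a) (rot L i b)"

definition geom_R ::
  "nat \<Rightarrow> (nat \<Rightarrow> complex) \<Rightarrow> (nat \<Rightarrow> complex) \<Rightarrow> (nat \<Rightarrow> complex) \<times> (nat \<Rightarrow> complex)" where
  "geom_R L a b =
     (\<lambda>i. b i * rot_E L a b i / rot_E L a b (i - 1),
      \<lambda>i. a i * rot_E L a b (i - 1) / rot_E L a b i)"

definition geom_R_defined :: "nat \<Rightarrow> (nat \<Rightarrow> complex) \<Rightarrow> (nat \<Rightarrow> complex) \<Rightarrow> bool" where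
  "geom_R_defined L a b \<longleftrightarrow> (\<forall>i\<in>{0..L}. rot_E L a b i \<noteq> 0)"


text \<open>
  Polynomial functions on the phase space; over the infinite field \<open>\<complex>\<close> these are the
  same as polynomials in the coordinates.
\<close>

inductive_set poly_fun :: "nat \<Rightarrow> nat \<Rightarrow> (point \<Rightarrow> complex) set" for m n where
  const: "(\<lambda>q. c) \<in> poly_fun m n"
| coord: "c \<in> block m n \<Longrightarrow> (\<lambda>q. q c) \<in> poly_fun m n"
| add: "f \<in> poly_fun m n \<Longrightarrow> g \<in> poly_fun m n \<Longrightarrow> (\<lambda>q. f q + g q) \<in> poly_fun m n"
| mult: "f \<in> poly_fun m n \<Longrightarrow> g \<in> poly_fun m n \<Longrightarrow> (\<lambda>q. f q * g q) \<in> poly_fun m n"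

definition zariski_dense :: "nat \<Rightarrow> nat \<Rightarrow> point set \<Rightarrow> bool" where
  "zariski_dense m n S \<longleftrightarrow>
     S \<subseteq> phase_space m n \<and>
     (\<forall>f\<in>poly_fun m n. (\<forall>q\<in>S. f q = 0) \<longrightarrow> (\<forall>q\<in>phase_space m n. f q = 0))"

text \<open>
  A rational map from the phase space to itself is represented by the partial function on its
  full domain of definition.  \<open>regular_value m n F q p\<close> says that the rational map given
  by a partial function \<open>F\<close> (with dense domain) is regular at \<open>q\<close> with value \<open>p\<close>:
  every coordinate of \<open>F\<close> is a quotient of polynomials whose denominator does not
  vanish at \<open>q\<close>.  \<open>rat_ext m n F\<close> is the resulting extension of \<open>F\<close> to all points of
  regularity; for dense domains the value is unique.
\<close>

definition regular_value :: "nat \<Rightarrow> nat \<Rightarrow> (point \<rightharpoonup> point) \<Rightarrow> point \<Rightarrow> point \<Rightarrow> bool" where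
  "regular_value m n F q p \<longleftrightarrow>
     q \<in> phase_space m n \<and> p \<in> phase_space m n \<and>
     (\<forall>c\<in>block m n. \<exists>f\<in>poly_fun m n. \<exists>g\<in>poly_fun m n.
        g q \<noteq> 0 \<and> p c = f q / g q \<and>
        (\<forall>q'\<in>dom F. g q' \<noteq> 0 \<longrightarrow> the (F q') c = f q' / g q'))"

definition rat_ext :: "nat \<Rightarrow> nat \<Rightarrow> (point \<rightharpoonup> point) \<Rightarrow> (point \<rightharpoonup> point)" where
  "rat_ext m n F = (\<lambda>q.
     if \<exists>!p. regular_value m n F q p then Some (THE p. regular_value m n F q p) else None)"

definition rational_maps :: "nat \<Rightarrow> nat \<Rightarrow> (point \<rightharpoonup> point) set" where
  "rational_maps m n = {F. zariski_dense m n (dom F) \<and> rat_ext m n F = F}"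

text \<open>Dominant rational self-maps form a monoid; the birational maps are its units.\<close>

definition dominant_monoid :: "nat \<Rightarrow> nat \<Rightarrow> (point \<rightharpoonup> point) monoid" where
  "dominant_monoid m n =
     \<lparr>carrier = {F \<in> rational_maps m n. zariski_dense m n (ran F)},
      monoid.mult = (\<lambda>F G. rat_ext m n (F \<circ>\<^sub>m G)),
      one = (\<lambda>q. if q \<in> phase_space m n then Some q else None)\<rparr>"

definition Bir :: "nat \<Rightarrow> nat \<Rightarrow> (point \<rightharpoonup> point) monoid" where
  "Bir m n = units_of (dominant_monoid m n)"


definition s_formula :: "nat \<Rightarrow> nat \<Rightarrow> nat \<Rightarrow> (point \<rightharpoonup> point)" where
  "s_formula m n r = (\<lambda>q.
     let a = (\<lambda>j. q (r, j)); b = (\<lambda>j. q (r + 1, j)) in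
     if q \<in> phase_space m n \<and> geom_R_defined n a b
     then Some (restrict (\<lambda>(i, j).
            if i = r then fst (geom_R n a b) j
            else if i = r + 1 then snd (geom_R n a b) j
            else q (i, j)) (block m n))
     else None)"

definition s_map :: "nat \<Rightarrow> nat \<Rightarrow> nat \<Rightarrow> (point \<rightharpoonup> point)" where
  "s_map m n r = rat_ext m n (s_formula m n r)"

definition pi_map :: "nat \<Rightarrow> nat \<Rightarrow> nat \<Rightarrow> (point \<rightharpoonup> point)" where
  "pi_map m n k = (\<lambda>q.
     if q \<in> phase_space m n
     then Some (restrict (\<lambda>(i, j). ext m n k q (int i + 1) (int j)) (block m n))
     else None)"

text \<open>The coordinates \<open>q\<^sub>m\<^sub>+\<^sub>1\<^sub>-\<^sub>l\<^sub>,\<^sub>N\<^sub>+\<^sub>1\<^sub>-\<^sub>r\<close> with \<open>N = gcd n k\<close>, where \<open>1 \<le> r \<le> N\<close> and \<open>1 \<le> l \<le> m * (n div N)\<close>.\<close>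

definition tilde :: "nat \<Rightarrow> nat \<Rightarrow> nat \<Rightarrow> point \<Rightarrow> nat \<Rightarrow> nat \<Rightarrow> complex" where
  "tilde m n k q r l = ext m n k q (int m + 1 - int l) (int (gcd n k) + 1 - int r)"

text \<open>
  A point is determined by its coordinates \<open>tilde\<close>, which may be prescribed freely; hence
  the description in the next definition is proper.
\<close>

definition ts_formula :: "nat \<Rightarrow> nat \<Rightarrow> nat \<Rightarrow> nat \<Rightarrow> (point \<rightharpoonup> point)" where
  "ts_formula m n k r = (\<lambda>q.
     let N = gcd n k; L = m * (n div N);
         a = tilde m n k q r; b = tilde m n k q (r + 1) in
     if q \<in> phase_space m n \<and> geom_R_defined L a b
     then Some (THE p. p \<in> phase_space m n \<and>
            (\<forall>t\<in>{1..N}. \<forall>l\<in>{1..L}.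
               tilde m n k p t l =
                 (if t = r then fst (geom_R L a b) l
                  else if t = r + 1 then snd (geom_R L a b) l
                  else tilde m n k q t l)))
     else None)"

definition ts_map :: "nat \<Rightarrow> nat \<Rightarrow> nat \<Rightarrow> nat \<Rightarrow> (point \<rightharpoonup> point)" where
  "ts_map m n k r = rat_ext m n (ts_formula m n k r)"

definition tpi_map :: "nat \<Rightarrow> nat \<Rightarrow> nat \<Rightarrow> (point \<rightharpoonup> point)" where
  "tpi_map m n k = (\<lambda>q.
     if q \<in> phase_space m n
     then Some (restrict (\<lambda>(i, j). ext m n k q (int i) (int j - 1)) (block m n))
     else None)"

definition W_grp :: "nat \<Rightarrow> nat \<Rightarrow> nat \<Rightarrow> (point \<rightharpoonup> point) monoid" where
  "W_grp m n k =
     (Bir m n)\<lparr>carrier :=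
        generate (Bir m n) (insert (pi_map m n k) (s_map m n ` {1..m - 1}))\<rparr>"

definition tW_grp :: "nat \<Rightarrow> nat \<Rightarrow> nat \<Rightarrow> (point \<rightharpoonup> point) monoid" where
  "tW_grp m n k =
     (Bir m n)\<lparr>carrier :=
        generate (Bir m n) (insert (tpi_map m n k) (ts_map m n k ` {1..gcd n k - 1}))\<rparr>"

text \<open>
  \<open>(w, w')\<close> in the product of the two groups acts as the birational map \<open>w \<circ> w'\<close>; \<open>None\<close>
  means that this map is not defined at the point.
\<close>

definition act ::
  "nat \<Rightarrow> nat \<Rightarrow> (point \<rightharpoonup> point) \<times> (point \<rightharpoonup> point) \<Rightarrow> (point \<rightharpoonup> point)" where
  "act m n w = fst w \<otimes>\<^bsub>Bir m n\<^esub> snd w"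

definition conserved_quantity :: "nat \<Rightarrow> nat \<Rightarrow> nat \<Rightarrow> (point \<Rightarrow> complex) \<Rightarrow> bool" where
  "conserved_quantity m n k f \<longleftrightarrow>
     (\<forall>w\<in>carrier (W_grp m n k \<times>\<times> tW_grp m n k). \<forall>q\<in>phase_space m n. \<forall>p.
        act m n w q = Some p \<longrightarrow> f p = f q)"

end

theory Submission
  imports Defs
begin

text \<open>
  A rational map that preserves a polynomial on the points where it is given by its formula
  preserves it on its full domain of definition, and this property survives composition, so only
  the generators and their inverses matter.

  Rotations of the rows or columns conjugate \<open>Q\<^sub>1 \<cdots> Q\<^sub>m P\<^sup>k\<close> by \<open>Q\<^sub>1\<close> or \<open>P\<close>.  The R-matrix
  preserves the products \<open>a\<^sub>j b\<^sub>j\<close> and the sums \<open>a\<^sub>j\<^sub>+\<^sub>1 + b\<^sub>j\<close>, which says precisely that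
  \<open>Q\<^sub>r Q\<^sub>r\<^sub>+\<^sub>1\<close> is unchanged by \<open>s\<^sub>r\<close>.  For the column action put \<open>t\<^sub>i\<^sub>j = q'\<^sub>i\<^sub>j - q\<^sub>i\<^sub>j\<close> if \<open>j \<equiv> N - r\<close>
  modulo \<open>N\<close> and \<open>t\<^sub>i\<^sub>j = 0\<close> otherwise; the same identities give \<open>Q'\<^sub>i T\<^sub>i\<^sub>+\<^sub>1 = T\<^sub>i Q\<^sub>i\<close> for the unipotent
  matrices \<open>T\<^sub>i = 1 + \<Sum>\<^sub>j t\<^sub>i\<^sub>j E\<^sub>j\<^sub>,\<^sub>j\<^sub>+\<^sub>1\<close>, and \<open>T\<^sub>m\<^sub>+\<^sub>1 P\<^sup>k = P\<^sup>k T\<^sub>1\<close>, so the product is conjugated by \<open>T\<^sub>1\<close>.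
\<close>

section \<open>Polynomial functions and rational maps\<close>

text \<open>Both groups are generated inside \<open>Bir m n\<close>, whose product is composition
  followed by \<open>rat_ext\<close> and whose inverse is a definite description. So inverses of
  generators are identified by hand: associativity of the product is never established, and
  \<open>rational_inverse_unique\<close> compares two candidate inverses pointwise on a dense set
  instead. Invariance must also hold at points reached only by extension, where no formula for the
  map is at hand; the argument there needs complex-valued polynomial functions, which is why each
  coefficient of \<open>psi\<close> is treated separately.

  The R-matrix is shown to be an involution only off the hypersurface where the two vectors have
  equal products of entries, which is enough for an identity of rational maps.

  The choice of \<open>t\<close> is forced: at the left one of two exchanged columns, the diagonal
  of \<open>Q' T = T Q\<close> says that \<open>t\<close> is the change of that column. The diagonal
  at the right one is then the sum identity, and the entries above the diagonal give the product
  identity.\<close>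

lemma poly_fun_prod:
  assumes "\<And>x. x \<in> A \<Longrightarrow> f x \<in> poly_fun m n"
  shows "(\<lambda>q. \<Prod>x\<in>A. f x q) \<in> poly_fun m n"
  using assms
proof (induction A rule: infinite_finite_induct)
  case (insert x F)
  then show ?case using poly_fun.mult[of "f x"] by simp
qed (auto intro: poly_fun.const)

lemma poly_fun_sum:
  assumes "\<And>x. x \<in> A \<Longrightarrow> f x \<in> poly_fun m n"
  shows "(\<lambda>q. \<Sum>x\<in>A. f x q) \<in> poly_fun m n"
  using assms
proof (induction A rule: infinite_finite_induct)
  case (insert x F)
  then show ?case using poly_fun.add[of "f x"] by simp
qed (auto intro: poly_fun.const)

lemma poly_fun_cmult: "f \<in> poly_fun m n \<Longrightarrow> (\<lambda>q. c * f q) \<in> poly_fun m n"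
  using poly_fun.mult[OF poly_fun.const] .

lemma poly_fun_diff:
  assumes "f \<in> poly_fun m n" "g \<in> poly_fun m n"
  shows "(\<lambda>q. f q - g q) \<in> poly_fun m n"
  using poly_fun.add[OF assms(1) poly_fun_cmult[OF assms(2), of "-1"]] by simp

section \<open>Irreducibility of the phase space and Zariski density\<close>

lemma finite_block: "finite (block m n)"
  by (simp add: block_def)

text \<open>Irreducibility is derived from polynomials in one variable: on a line through two points
  a polynomial function has only finitely many zeros unless it vanishes on all of it.\<close>

lemma poly_fun_on_line:
  fixes q0 q1 :: point and m n :: nat
  defines "line \<equiv> \<lambda>t. restrict (\<lambda>c. q0 c + t * (q1 c - q0 c)) (block m n)"
  assumes "f \<in> poly_fun m n"
  shows "\<exists>P. \<forall>t. f (line t) = poly P t"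
  using assms(2)
proof induction
  case (const c)
  show ?case by (rule exI[of _ "[:c:]"]) simp
next
  case (coord c)
  then show ?case by (intro exI[of _ "[:q0 c, q1 c - q0 c:]"]) (simp add: line_def)
next
  case (add f g)
  then obtain P Q where PQ: "\<And>t. f (line t) = poly P t" "\<And>t. g (line t) = poly Q t" by blast
  show ?case by (rule exI[of _ "P + Q"]) (simp only: poly_add PQ simp_thms)
next
  case (mult f g)
  then obtain P Q where PQ: "\<And>t. f (line t) = poly P t" "\<And>t. g (line t) = poly Q t" by blast
  show ?case by (rule exI[of _ "P * Q"]) (simp only: poly_mult PQ simp_thms)
qed

text \<open>Two nonempty open sets meet: on the line through \<open>q0\<close> and \<open>q1\<close>
  neither function vanishes identically, and the finitely many roots of the product cannot exhaust
  an infinite field.\<close>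

lemma poly_fun_common_nonzero:
  assumes fg: "f \<in> poly_fun m n" "g \<in> poly_fun m n"
    and q: "q0 \<in> phase_space m n" "q1 \<in> phase_space m n" "g q0 \<noteq> 0" "f q1 \<noteq> 0"
  shows "\<exists>q\<in>phase_space m n. f q \<noteq> 0 \<and> g q \<noteq> 0"
proof -
  define line where "line t = restrict (\<lambda>c. q0 c + t * (q1 c - q0 c)) (block m n)" for t
  have ends: "line 0 = q0" "line 1 = q1"
    using q by (auto simp: line_def phase_space_def PiE_def extensional_def fun_eq_iff)
  obtain P Q where PQ: "\<And>t. f (line t) = poly P t" "\<And>t. g (line t) = poly Q t"
    using poly_fun_on_line[OF fg(1), of q0 q1] poly_fun_on_line[OF fg(2), of q0 q1]
    unfolding line_def by blast
  have "P \<noteq> 0" "Q \<noteq> 0"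
    using q PQ[of 0] PQ[of 1] ends by auto
  then have "finite {t. poly (P * Q) t = 0}"
    using poly_roots_finite[of "P * Q"] by auto
  then have "{t. poly (P * Q) t = 0} \<noteq> UNIV"
    using infinite_UNIV_char_0[where 'a = complex] by metis
  then obtain t where "poly (P * Q) t \<noteq> 0" by blast
  then show ?thesis
    using PQ by (intro bexI[of _ "line t"]) (auto simp: line_def phase_space_def)
qed

lemma zariski_denseD:
  assumes S: "zariski_dense m n S" and f: "f \<in> poly_fun m n" "\<And>q. q \<in> S \<Longrightarrow> f q = 0"
    and q: "q \<in> phase_space m n"
  shows "f q = 0"
proof -
  have "(\<forall>q\<in>S. f q = 0) \<longrightarrow> (\<forall>q\<in>phase_space m n. f q = 0)"
    using S f(1) by (simp add: zariski_dense_def)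
  then show ?thesis using f(2) q by simp
qed

text \<open>If \<open>f\<close> vanishes on the smaller set, then \<open>f * g\<close> vanishes on
  \<open>S\<close>, hence everywhere, and irreducibility leaves no point where \<open>f\<close> is
  nonzero.\<close>

lemma zariski_dense_inter_nonzero:
  assumes S: "zariski_dense m n S" and g: "g \<in> poly_fun m n" "q0 \<in> phase_space m n" "g q0 \<noteq> 0"
  shows "zariski_dense m n {q \<in> S. g q \<noteq> 0}"
  unfolding zariski_dense_def
proof (intro conjI ballI impI)
  show "{q \<in> S. g q \<noteq> 0} \<subseteq> phase_space m n"
    using S by (auto simp: zariski_dense_def)
  fix f q assume f: "f \<in> poly_fun m n" "\<forall>q\<in>{q \<in> S. g q \<noteq> 0}. f q = 0" and q: "q \<in> phase_space m n"
  have "f q * g q = 0" if "q \<in> phase_space m n" for q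
    by (rule zariski_denseD[OF S poly_fun.mult[OF f(1) g(1)] _ that]) (use f(2) in auto)
  then show "f q = 0"
    using poly_fun_common_nonzero[OF f(1) g(1) g(2) q g(3)] by auto
qed

lemma zariski_dense_phase_space: "zariski_dense m n (phase_space m n)"
  by (simp add: zariski_dense_def)

lemma zariski_dense_nonzero:
  assumes "g \<in> poly_fun m n" "q0 \<in> phase_space m n" "g q0 \<noteq> 0"
  shows "zariski_dense m n {q \<in> phase_space m n. g q \<noteq> 0}"
  using zariski_dense_inter_nonzero[OF zariski_dense_phase_space assms] .

lemma zariski_dense_mono:
  assumes "zariski_dense m n S" "S \<subseteq> T" "T \<subseteq> phase_space m n"
  shows "zariski_dense m n T"
  unfolding zariski_dense_def
proof (intro conjI ballI impI assms(3))
  fix f q assume "f \<in> poly_fun m n" "\<forall>q\<in>T. f q = 0" "q \<in> phase_space m n"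
  then show "f q = 0" using assms(2) by (intro zariski_denseD[OF assms(1), of f q]) auto
qed

section \<open>Regular values and fractions of polynomial functions\<close>

lemma regular_value_phase:
  "regular_value m n F q p \<Longrightarrow> q \<in> phase_space m n"
  "regular_value m n F q p \<Longrightarrow> p \<in> phase_space m n"
  by (simp_all add: regular_value_def)

lemma regular_valueI:
  assumes "q \<in> phase_space m n" "p \<in> phase_space m n"
    and "\<And>c. c \<in> block m n \<Longrightarrow> \<exists>f g. f \<in> poly_fun m n \<and> g \<in> poly_fun m n \<and>
        g q \<noteq> 0 \<and> p c = f q / g q \<and> (\<forall>q' p'. F q' = Some p' \<longrightarrow> g q' \<noteq> 0 \<longrightarrow> p' c = f q' / g q')"
  shows "regular_value m n F q p"
  unfolding regular_value_def
proof (intro conjI ballI assms(1,2))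
  fix c assume "c \<in> block m n"
  from assms(3)[OF this] obtain f g where fg: "f \<in> poly_fun m n" "g \<in> poly_fun m n"
    "g q \<noteq> 0" "p c = f q / g q" "\<forall>q' p'. F q' = Some p' \<longrightarrow> g q' \<noteq> 0 \<longrightarrow> p' c = f q' / g q'" by blast
  show "\<exists>f\<in>poly_fun m n. \<exists>g\<in>poly_fun m n. g q \<noteq> 0 \<and> p c = f q / g q \<and>
            (\<forall>q'\<in>dom F. g q' \<noteq> 0 \<longrightarrow> the (F q') c = f q' / g q')"
    by (rule bexI[OF _ fg(1)], rule bexI[OF _ fg(2)]) (use fg(3-) in auto)
qed

lemma regular_value_coordE:
  assumes "regular_value m n F q p" "c \<in> block m n"
  obtains f g where "f \<in> poly_fun m n" "g \<in> poly_fun m n" "g q \<noteq> 0" "p c = f q / g q"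
    "\<forall>q' p'. F q' = Some p' \<longrightarrow> g q' \<noteq> 0 \<longrightarrow> p' c = f q' / g q'"
proof -
  from assms obtain f g where fg: "f \<in> poly_fun m n" "g \<in> poly_fun m n" "g q \<noteq> 0" "p c = f q / g q"
    "\<forall>q'\<in>dom F. g q' \<noteq> 0 \<longrightarrow> the (F q') c = f q' / g q'"
    unfolding regular_value_def by blast
  show ?thesis
  proof (rule that[OF fg(1-4)], intro allI impI)
    fix q' p' assume "F q' = Some p'" "g q' \<noteq> 0"
    then show "p' c = f q' / g q'" using fg(5) by (metis domI option.sel)
  qed
qed

text \<open>Here \<open>G\<close> is the product of the denominators of all coordinates.\<close>

lemma regular_valueE:
  assumes "regular_value m n F q p"
  obtains f g G where
    "\<forall>c\<in>block m n. f c \<in> poly_fun m n" "\<forall>c\<in>block m n. g c \<in> poly_fun m n"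
    "G \<in> poly_fun m n" "G q \<noteq> 0" "\<forall>c\<in>block m n. \<forall>q'. G q' \<noteq> 0 \<longrightarrow> g c q' \<noteq> 0"
    "\<forall>c\<in>block m n. p c = f c q / g c q"
    "\<forall>c\<in>block m n. \<forall>q' p'. F q' = Some p' \<longrightarrow> G q' \<noteq> 0 \<longrightarrow> p' c = f c q' / g c q'"
proof -
  have "\<forall>c\<in>block m n. \<exists>f g. f \<in> poly_fun m n \<and> g \<in> poly_fun m n \<and>
        g q \<noteq> 0 \<and> p c = f q / g q \<and> (\<forall>q' p'. F q' = Some p' \<longrightarrow> g q' \<noteq> 0 \<longrightarrow> p' c = f q' / g q')"
  proof
    fix c assume "c \<in> block m n"
    with assms obtain f g where "f \<in> poly_fun m n" "g \<in> poly_fun m n" "g q \<noteq> 0" "p c = f q / g q"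
      "\<forall>q' p'. F q' = Some p' \<longrightarrow> g q' \<noteq> 0 \<longrightarrow> p' c = f q' / g q'"
      by (rule regular_value_coordE)
    then show "\<exists>f g. f \<in> poly_fun m n \<and> g \<in> poly_fun m n \<and> g q \<noteq> 0 \<and> p c = f q / g q \<and>
        (\<forall>q' p'. F q' = Some p' \<longrightarrow> g q' \<noteq> 0 \<longrightarrow> p' c = f q' / g q')"
      by (intro exI conjI)
  qed
  then obtain f g where fg: "\<And>c. c \<in> block m n \<Longrightarrow> f c \<in> poly_fun m n \<and> g c \<in> poly_fun m n \<and>
        g c q \<noteq> 0 \<and> p c = f c q / g c q \<and>
        (\<forall>q' p'. F q' = Some p' \<longrightarrow> g c q' \<noteq> 0 \<longrightarrow> p' c = f c q' / g c q')"
    by metis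
  define G where "G = (\<lambda>q. \<Prod>c\<in>block m n. g c q)"
  have G0: "g c q' \<noteq> 0" if "c \<in> block m n" "G q' \<noteq> 0" for c q'
    using that finite_block[of m n] by (auto simp: G_def)
  show ?thesis
  proof (rule that[of f g G])
    show "G \<in> poly_fun m n"
      unfolding G_def using fg by (intro poly_fun_prod) auto
    show "G q \<noteq> 0"
      using fg finite_block[of m n] by (auto simp: G_def)
  qed (use fg G0 in auto)
qed

text \<open>Common denominators. One pair \<open>h\<close>, \<open>k\<close> is chosen before
  \<open>q\<close> and \<open>p\<close>, so that the same fraction computes \<open>\<Phi>\<close> at
  every point where no denominator vanishes.\<close>

lemma poly_fun_subst:
  assumes \<Phi>: "\<Phi> \<in> poly_fun m n"
    and fg: "\<And>c. c \<in> block m n \<Longrightarrow> f c \<in> poly_fun m n" "\<And>c. c \<in> block m n \<Longrightarrow> g c \<in> poly_fun m n"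
  shows "\<exists>h k. h \<in> poly_fun m n \<and> k \<in> poly_fun m n \<and>
    (\<forall>q p. (\<forall>c\<in>block m n. g c q \<noteq> 0 \<and> p c = f c q / g c q) \<longrightarrow> k q \<noteq> 0 \<and> \<Phi> p = h q / k q)"
  using \<Phi>
proof induction
  case (const c)
  show ?case
    by (rule exI[of _ "\<lambda>_. c"], rule exI[of _ "\<lambda>_. 1"]) (auto intro: poly_fun.const)
next
  case (coord c)
  show ?case
    by (rule exI[of _ "f c"], rule exI[of _ "g c"]) (use coord fg in auto)
next
  case (add \<Phi> \<Psi>)
  obtain h k where hk: "h \<in> poly_fun m n" "k \<in> poly_fun m n"
    "\<And>q p. (\<forall>c\<in>block m n. g c q \<noteq> 0 \<and> p c = f c q / g c q) \<Longrightarrow> k q \<noteq> 0 \<and> \<Phi> p = h q / k q"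
    using add.IH(1) by blast
  obtain h' k' where hk': "h' \<in> poly_fun m n" "k' \<in> poly_fun m n"
    "\<And>q p. (\<forall>c\<in>block m n. g c q \<noteq> 0 \<and> p c = f c q / g c q) \<Longrightarrow> k' q \<noteq> 0 \<and> \<Psi> p = h' q / k' q"
    using add.IH(2) by blast
  define u where "u = (\<lambda>q. h q * k' q + h' q * k q)"
  define v where "v = (\<lambda>q. k q * k' q)"
  have "u \<in> poly_fun m n" "v \<in> poly_fun m n"
    unfolding u_def v_def using hk(1,2) hk'(1,2) by (auto intro!: poly_fun.add poly_fun.mult)
  moreover have "v q \<noteq> 0 \<and> \<Phi> p + \<Psi> p = u q / v q" if "(\<forall>c\<in>block m n. g c q \<noteq> 0 \<and> p c = f c q / g c q)" for q p
    using hk(3)[OF that] hk'(3)[OF that] by (simp add: u_def v_def add_frac_eq)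
  ultimately show ?case by blast
next
  case (mult \<Phi> \<Psi>)
  obtain h k where hk: "h \<in> poly_fun m n" "k \<in> poly_fun m n"
    "\<And>q p. (\<forall>c\<in>block m n. g c q \<noteq> 0 \<and> p c = f c q / g c q) \<Longrightarrow> k q \<noteq> 0 \<and> \<Phi> p = h q / k q"
    using mult.IH(1) by blast
  obtain h' k' where hk': "h' \<in> poly_fun m n" "k' \<in> poly_fun m n"
    "\<And>q p. (\<forall>c\<in>block m n. g c q \<noteq> 0 \<and> p c = f c q / g c q) \<Longrightarrow> k' q \<noteq> 0 \<and> \<Psi> p = h' q / k' q"
    using mult.IH(2) by blast
  define u where "u = (\<lambda>q. h q * h' q)"
  define v where "v = (\<lambda>q. k q * k' q)"
  have "u \<in> poly_fun m n" "v \<in> poly_fun m n"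
    unfolding u_def v_def using hk(1,2) hk'(1,2) by (auto intro!: poly_fun.add poly_fun.mult)
  moreover have "v q \<noteq> 0 \<and> \<Phi> p * \<Psi> p = u q / v q" if "(\<forall>c\<in>block m n. g c q \<noteq> 0 \<and> p c = f c q / g c q)" for q p
    using hk(3)[OF that] hk'(3)[OF that] by (simp add: u_def v_def)
  ultimately show ?case by blast
qed

text \<open>Off the Zariski closure of \<open>dom F\<close> every value is regular, so \<open>rat_ext\<close> is undefined there.\<close>

lemma rat_ext_in_closure:
  assumes mn: "m \<ge> 1" "n \<ge> 1" and q: "rat_ext m n F q = Some p"
    and g: "g \<in> poly_fun m n" "\<And>q'. q' \<in> dom F \<Longrightarrow> g q' = 0"
  shows "g q = 0"
proof (rule ccontr)
  assume gq: "g q \<noteq> 0"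
  have ex1: "\<exists>!p. regular_value m n F q p"
    using q by (auto simp: rat_ext_def split: if_splits)
  then have qs: "q \<in> phase_space m n"
    using regular_value_phase by blast
  have any: "regular_value m n F q p" if "p \<in> phase_space m n" for p
  proof (rule regular_valueI[OF qs that])
    fix c
    show "\<exists>f g. f \<in> poly_fun m n \<and> g \<in> poly_fun m n \<and> g q \<noteq> 0 \<and> p c = f q / g q \<and>
            (\<forall>q' p'. F q' = Some p' \<longrightarrow> g q' \<noteq> 0 \<longrightarrow> p' c = f q' / g q')"
      by (rule exI[of _ "\<lambda>q. p c * g q"], rule exI[of _ g])
         (use g gq poly_fun_cmult in auto)
  qed
  \<comment> \<open>As \<open>m \<ge> 1\<close> and \<open>n \<ge> 1\<close>, the block is nonempty,
    so these are two different points, and both would be regular values.\<close>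
  have "restrict (\<lambda>_. 0) (block m n) \<in> phase_space m n" "restrict (\<lambda>_. 1) (block m n) \<in> phase_space m n"
    by (auto simp: phase_space_def)
  with ex1 any have eq: "restrict (\<lambda>_. 0::complex) (block m n) = restrict (\<lambda>_. 1) (block m n)"
    by blast
  have "(1, 1) \<in> block m n" using mn by (auto simp: block_def)
  then show False using fun_cong[OF eq, of "(1, 1)"] by simp
qed

lemma rat_ext_regular:
  assumes "rat_ext m n F q = Some p"
  shows "regular_value m n F q p"
proof -
  have "\<exists>!p. regular_value m n F q p"
    using assms by (metis (no_types) rat_ext_def option.distinct(1))
  from theI'[OF this] show ?thesis
    using assms by (simp add: rat_ext_def split: if_splits)
qed

lemma fractions_agree:
  assumes S: "zariski_dense m n S"
    and pf: "f \<in> poly_fun m n" "g \<in> poly_fun m n" "f' \<in> poly_fun m n" "g' \<in> poly_fun m n"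
    and agree: "\<And>q. q \<in> S \<Longrightarrow> g q \<noteq> 0 \<Longrightarrow> g' q \<noteq> 0 \<Longrightarrow> f q / g q = f' q / g' q"
    and q: "q \<in> phase_space m n" "g q \<noteq> 0" "g' q \<noteq> 0"
  shows "f q / g q = f' q / g' q"
proof -
  \<comment> \<open>The factor \<open>g q * g' q\<close> makes the expression vanish on all of
    \<open>S\<close>, also where a denominator is zero and \<open>agree\<close> says
    nothing.\<close>
  have "(\<lambda>q. (f q * g' q - f' q * g q) * (g q * g' q)) \<in> poly_fun m n"
    by (intro poly_fun.mult poly_fun_diff pf)
  from zariski_denseD[OF S this _ q(1)]
  have "(f q * g' q - f' q * g q) * (g q * g' q) = 0"
    using agree by (force simp: frac_eq_eq)
  then show ?thesis using q by (auto simp: frac_eq_eq)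
qed

lemma regular_value_unique:
  assumes F: "zariski_dense m n (dom F)"
    and p: "regular_value m n F q p" "regular_value m n F q p'"
  shows "p = p'"
proof -
  have "p c = p' c" if c: "c \<in> block m n" for c
  proof -
    obtain f g where fg: "f \<in> poly_fun m n" "g \<in> poly_fun m n" "g q \<noteq> 0" "p c = f q / g q"
        "\<forall>q' p'. F q' = Some p' \<longrightarrow> g q' \<noteq> 0 \<longrightarrow> p' c = f q' / g q'"
      using p(1) c by (rule regular_value_coordE)
    obtain f' g' where fg': "f' \<in> poly_fun m n" "g' \<in> poly_fun m n" "g' q \<noteq> 0" "p' c = f' q / g' q"
        "\<forall>q' p'. F q' = Some p' \<longrightarrow> g' q' \<noteq> 0 \<longrightarrow> p' c = f' q' / g' q'"
      using p(2) c by (rule regular_value_coordE)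
    have "f q / g q = f' q / g' q"
      by (rule fractions_agree[OF F fg(1,2) fg'(1,2) _ regular_value_phase(1)[OF p(1)] fg(3) fg'(3)])
         (use fg(5) fg'(5) in force)
    then show ?thesis using fg fg' by simp
  qed
  then show ?thesis
    using p regular_value_phase(2)[of m n F q] unfolding phase_space_def
    by (metis PiE_ext)
qed

lemma rat_ext_eqI:
  assumes "zariski_dense m n (dom F)" "regular_value m n F q p"
  shows "rat_ext m n F q = Some p"
proof -
  have "\<exists>!p. regular_value m n F q p"
    using assms regular_value_unique by blast
  moreover from this have "(THE p. regular_value m n F q p) = p"
    using assms(2) by (metis the1_equality)
  ultimately show ?thesis by (simp add: rat_ext_def)
qed

text \<open>Unlike membership in \<open>rational_maps\<close>, this asks neither for a dense nor for
  a maximal domain. It is therefore stable under plain composition, before \<open>rat_ext\<close> is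
  applied.\<close>

definition locally_rational :: "nat \<Rightarrow> nat \<Rightarrow> (point \<rightharpoonup> point) \<Rightarrow> bool" where
  "locally_rational m n F \<longleftrightarrow> (\<forall>q p. F q = Some p \<longrightarrow> regular_value m n F q p)"

lemma regular_value_restrict:
  assumes "F \<subseteq>\<^sub>m F'" "regular_value m n F' q p"
  shows "regular_value m n F q p"
proof (rule regular_valueI)
  fix c assume "c \<in> block m n"
  with assms(2) obtain f g where fg: "f \<in> poly_fun m n" "g \<in> poly_fun m n" "g q \<noteq> 0" "p c = f q / g q"
      "\<forall>q' p'. F' q' = Some p' \<longrightarrow> g q' \<noteq> 0 \<longrightarrow> p' c = f q' / g q'"
    by (rule regular_value_coordE)
  moreover have "F' q' = Some p'" if "F q' = Some p'" for q' p'
    using assms(1) that by (metis domI map_le_def)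
  ultimately show "\<exists>f g. f \<in> poly_fun m n \<and> g \<in> poly_fun m n \<and> g q \<noteq> 0 \<and> p c = f q / g q \<and>
            (\<forall>q' p'. F q' = Some p' \<longrightarrow> g q' \<noteq> 0 \<longrightarrow> p' c = f q' / g q')"
    by blast
qed (use assms regular_value_phase in auto)

text \<open>At a point of \<open>dom F'\<close> a coordinate has two candidate fractions, the one
  belonging to \<open>p\<close> and the one belonging to the value there. Both represent
  \<open>F\<close> on its dense domain, so \<open>fractions_agree\<close> identifies them.\<close>

lemma regular_value_extend:
  assumes F: "zariski_dense m n (dom F)"
    and F': "\<And>q p. F' q = Some p \<Longrightarrow> regular_value m n F q p"
    and p: "regular_value m n F q p"
  shows "regular_value m n F' q p"
proof (rule regular_valueI)
  fix c assume c: "c \<in> block m n"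
  with p obtain f g where fg: "f \<in> poly_fun m n" "g \<in> poly_fun m n" "g q \<noteq> 0" "p c = f q / g q"
      "\<forall>q' p'. F q' = Some p' \<longrightarrow> g q' \<noteq> 0 \<longrightarrow> p' c = f q' / g q'"
    by (rule regular_value_coordE)
  have "p1 c = f q1 / g q1" if p1: "F' q1 = Some p1" "g q1 \<noteq> 0" for q1 p1
  proof -
    note r = F'[OF p1(1)]
    obtain f' g' where fg': "f' \<in> poly_fun m n" "g' \<in> poly_fun m n" "g' q1 \<noteq> 0" "p1 c = f' q1 / g' q1"
        "\<forall>q' p'. F q' = Some p' \<longrightarrow> g' q' \<noteq> 0 \<longrightarrow> p' c = f' q' / g' q'"
      using r c by (rule regular_value_coordE)
    have "f q1 / g q1 = f' q1 / g' q1"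
      by (rule fractions_agree[OF F fg(1,2) fg'(1,2) _ regular_value_phase(1)[OF r] p1(2) fg'(3)])
         (use fg(5) fg'(5) in force)
    then show ?thesis using fg' by simp
  qed
  then show "\<exists>f g. f \<in> poly_fun m n \<and> g \<in> poly_fun m n \<and> g q \<noteq> 0 \<and> p c = f q / g q \<and>
            (\<forall>q' p'. F' q' = Some p' \<longrightarrow> g q' \<noteq> 0 \<longrightarrow> p' c = f q' / g q')"
    using fg by blast
qed (use p regular_value_phase in auto)

lemma locally_rational_dom: "locally_rational m n F \<Longrightarrow> dom F \<subseteq> phase_space m n"
  by (auto simp: locally_rational_def dest: regular_value_phase(1))

text \<open>Rational maps are compared through this: two of them that share a restriction to a dense
  set have the same extension.\<close>

lemma rat_ext_dense_sub:
  assumes "F \<subseteq>\<^sub>m F'" "zariski_dense m n (dom F)" "locally_rational m n F'"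
  shows "rat_ext m n F = rat_ext m n F'"
proof -
  have "regular_value m n F' q p" if "regular_value m n F q p" for q p
    using regular_value_extend[OF assms(2) _ that, of F'] regular_value_restrict[OF assms(1)] assms(3)
    unfolding locally_rational_def by blast
  then have "regular_value m n F = regular_value m n F'"
    using regular_value_restrict[OF assms(1)] by (auto simp: fun_eq_iff)
  then show ?thesis unfolding rat_ext_def by (rule arg_cong)
qed

lemma rat_ext_extends:
  assumes "zariski_dense m n (dom F)" "locally_rational m n F"
  shows "F \<subseteq>\<^sub>m rat_ext m n F"
  unfolding map_le_def
proof
  fix q assume "q \<in> dom F"
  then obtain p where "F q = Some p" by blast
  moreover from this have "rat_ext m n F q = Some p"
    by (intro rat_ext_eqI[OF assms(1)]) (use assms(2) in \<open>simp add: locally_rational_def\<close>)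
  ultimately show "F q = rat_ext m n F q" by simp
qed

lemma locally_rational_rat_ext:
  assumes "zariski_dense m n (dom F)"
  shows "locally_rational m n (rat_ext m n F)"
  unfolding locally_rational_def
proof (intro allI impI)
  fix q p assume "rat_ext m n F q = Some p"
  from regular_value_extend[OF assms rat_ext_regular rat_ext_regular[OF this]]
  show "regular_value m n (rat_ext m n F) q p" .
qed

lemma rational_maps_rat_ext:
  assumes "zariski_dense m n (dom F)" "locally_rational m n F"
  shows "rat_ext m n F \<in> rational_maps m n"
proof -
  have "dom F \<subseteq> dom (rat_ext m n F)"
    using rat_ext_extends[OF assms] by (rule map_le_implies_dom_le)
  moreover have "dom (rat_ext m n F) \<subseteq> phase_space m n"
    using locally_rational_dom[OF locally_rational_rat_ext[OF assms(1)]] .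
  ultimately show ?thesis
    using rat_ext_dense_sub[OF rat_ext_extends[OF assms] assms(1) locally_rational_rat_ext[OF assms(1)]]
      zariski_dense_mono[OF assms(1)]
    by (simp add: rational_maps_def)
qed

lemma locally_rational_rational_maps:
  "F \<in> rational_maps m n \<Longrightarrow> locally_rational m n F"
  using locally_rational_rat_ext[of m n F] by (simp add: rational_maps_def)

text \<open>Take the points where the denominators belonging to \<open>q\<close> do not vanish: the
  same fractions give a regular value there, and a map equal to its own extension is defined at
  every such point.\<close>

lemma rational_maps_dom_open:
  assumes F: "F \<in> rational_maps m n" and q: "q \<in> dom F"
  obtains g where "g \<in> poly_fun m n" "g q \<noteq> 0"
    "\<And>q'. q' \<in> phase_space m n \<Longrightarrow> g q' \<noteq> 0 \<Longrightarrow> q' \<in> dom F"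
proof -
  have dense: "zariski_dense m n (dom F)" and ext: "rat_ext m n F = F"
    using F by (auto simp: rational_maps_def)
  obtain p where "regular_value m n F q p"
    using q locally_rational_rational_maps[OF F] by (auto simp: locally_rational_def)
  then obtain f g G where fgG':
    "\<forall>c\<in>block m n. f c \<in> poly_fun m n" "\<forall>c\<in>block m n. g c \<in> poly_fun m n"
    "G \<in> poly_fun m n" "G q \<noteq> 0" "\<forall>c\<in>block m n. \<forall>q'. G q' \<noteq> 0 \<longrightarrow> g c q' \<noteq> 0"
    "\<forall>c\<in>block m n. p c = f c q / g c q"
    "\<forall>c\<in>block m n. \<forall>q' p'. F q' = Some p' \<longrightarrow> G q' \<noteq> 0 \<longrightarrow> p' c = f c q' / g c q'"
    by (rule regular_valueE)
  note fgG = fgG'[rule_format]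
  have "q' \<in> dom F" if q': "q' \<in> phase_space m n" "G q' \<noteq> 0" for q'
  proof -
    define p' where "p' = restrict (\<lambda>c. f c q' / g c q') (block m n)"
    have "regular_value m n F q' p'"
    proof (rule regular_valueI[OF q'(1)])
      show "p' \<in> phase_space m n" by (auto simp: p'_def phase_space_def)
      fix c assume c: "c \<in> block m n"
      \<comment> \<open>Both parts of the fraction get the factor \<open>G\<close>, since
        \<open>f c / g c\<close> is known to represent \<open>F\<close> only where \<open>G\<close>
        is nonzero.\<close>
      have "(\<lambda>x. f c x * G x) \<in> poly_fun m n \<and> (\<lambda>x. g c x * G x) \<in> poly_fun m n"
        using poly_fun.mult fgG(1,2)[OF c] fgG(3) by blast
      moreover have "x c = f c y * G y / (g c y * G y)" if "F y = Some x" "g c y * G y \<noteq> 0" for x y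
        using fgG(7)[OF c that(1)] that(2) by auto
      moreover have "g c q' * G q' \<noteq> 0 \<and> p' c = f c q' * G q' / (g c q' * G q')"
        using fgG(5)[OF c q'(2)] q'(2) c by (simp add: p'_def)
      ultimately show "\<exists>f g. f \<in> poly_fun m n \<and> g \<in> poly_fun m n \<and> g q' \<noteq> 0 \<and> p' c = f q' / g q' \<and>
            (\<forall>q'' p''. F q'' = Some p'' \<longrightarrow> g q'' \<noteq> 0 \<longrightarrow> p'' c = f q'' / g q'')"
        by (intro exI[of _ "\<lambda>x. f c x * G x"] exI[of _ "\<lambda>x. g c x * G x"]) blast
    qed
    from rat_ext_eqI[OF dense this] show ?thesis by (auto simp: ext)
  qed
  with that fgG(3,4) show ?thesis by blast
qed

lemma locally_rational_comp:
  assumes F: "locally_rational m n F" and G: "locally_rational m n G"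
  shows "locally_rational m n (F \<circ>\<^sub>m G)"
  unfolding locally_rational_def
proof (intro allI impI)
  fix q p assume "(F \<circ>\<^sub>m G) q = Some p"
  then obtain q1 where q1: "G q = Some q1" "F q1 = Some p" by (auto simp: map_comp_Some_iff)
  have rF: "regular_value m n F q1 p" and rG: "regular_value m n G q q1"
    using F G q1 by (auto simp: locally_rational_def)
  from rG obtain f g D where fgD':
    "\<forall>c\<in>block m n. f c \<in> poly_fun m n" "\<forall>c\<in>block m n. g c \<in> poly_fun m n"
    "D \<in> poly_fun m n" "D q \<noteq> 0" "\<forall>c\<in>block m n. \<forall>q'. D q' \<noteq> 0 \<longrightarrow> g c q' \<noteq> 0"
    "\<forall>c\<in>block m n. q1 c = f c q / g c q"
    "\<forall>c\<in>block m n. \<forall>q' p'. G q' = Some p' \<longrightarrow> D q' \<noteq> 0 \<longrightarrow> p' c = f c q' / g c q'"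
    by (rule regular_valueE)
  note fgD = fgD'[rule_format]
  have fractions: "\<forall>c\<in>block m n. g c q' \<noteq> 0 \<and> p' c = f c q' / g c q'" if "G q' = Some p'" "D q' \<noteq> 0" for q' p'
    using fgD that by blast
  show "regular_value m n (F \<circ>\<^sub>m G) q p"
  proof (rule regular_valueI)
    fix c assume "c \<in> block m n"
    with rF obtain f1 g1 where fg1: "f1 \<in> poly_fun m n" "g1 \<in> poly_fun m n" "g1 q1 \<noteq> 0" "p c = f1 q1 / g1 q1"
        "\<forall>q' p'. F q' = Some p' \<longrightarrow> g1 q' \<noteq> 0 \<longrightarrow> p' c = f1 q' / g1 q'"
      by (rule regular_value_coordE)
    obtain h k where hk_ex: "h \<in> poly_fun m n" "k \<in> poly_fun m n"
      "\<And>q' p'. (\<forall>c\<in>block m n. g c q' \<noteq> 0 \<and> p' c = f c q' / g c q') \<Longrightarrow> k q' \<noteq> 0 \<and> f1 p' = h q' / k q'"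
      using poly_fun_subst[OF fg1(1), of f g] fgD(1,2) by blast
    have hk: "k q' \<noteq> 0 \<and> f1 p' = h q' / k q'" if "G q' = Some p'" "D q' \<noteq> 0" for q' p'
      using hk_ex(3)[OF fractions[OF that]] .
    obtain h' k' where hk'_ex: "h' \<in> poly_fun m n" "k' \<in> poly_fun m n"
      "\<And>q' p'. (\<forall>c\<in>block m n. g c q' \<noteq> 0 \<and> p' c = f c q' / g c q') \<Longrightarrow> k' q' \<noteq> 0 \<and> g1 p' = h' q' / k' q'"
      using poly_fun_subst[OF fg1(2), of f g] fgD(1,2) by blast
    have hk': "k' q' \<noteq> 0 \<and> g1 p' = h' q' / k' q'" if "G q' = Some p'" "D q' \<noteq> 0" for q' p'
      using hk'_ex(3)[OF fractions[OF that]] .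
    \<comment> \<open>The quotient of \<open>h / k\<close> by \<open>h' / k'\<close>; the factor
      \<open>D\<close> removes the points where some denominator of \<open>G\<close>
      vanishes.\<close>
    define u where "u = (\<lambda>x. h x * k' x * D x)"
    define v where "v = (\<lambda>x. k x * h' x * D x)"
    have "v q \<noteq> 0" "p c = u q / v q"
      using hk[OF q1(1) fgD(4)] hk'[OF q1(1) fgD(4)] fgD(4) fg1(3,4) by (auto simp: u_def v_def)
    moreover have "z c = u x / v x" if x: "(F \<circ>\<^sub>m G) x = Some z" and nz: "v x \<noteq> 0" for x z
    proof -
      obtain y where yz: "G x = Some y" "F y = Some z"
        using x by (auto simp: map_comp_Some_iff)
      have "D x \<noteq> 0" using nz by (auto simp: v_def)
      note a = hk[OF yz(1) this] hk'[OF yz(1) this]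
      have "g1 y \<noteq> 0" using a nz by (auto simp: v_def)
      then have "z c = f1 y / g1 y" using fg1(5) yz(2) by blast
      with a nz show ?thesis by (simp add: u_def v_def)
    qed
    moreover have "u \<in> poly_fun m n" "v \<in> poly_fun m n"
      unfolding u_def v_def using hk_ex(1,2) hk'_ex(1,2) fgD(3) by (auto intro!: poly_fun.mult)
    ultimately show "\<exists>f g. f \<in> poly_fun m n \<and> g \<in> poly_fun m n \<and> g q \<noteq> 0 \<and> p c = f q / g q \<and>
            (\<forall>q' p'. (F \<circ>\<^sub>m G) q' = Some p' \<longrightarrow> g q' \<noteq> 0 \<longrightarrow> p' c = f q' / g q')"
      by blast
  qed (use rF rG regular_value_phase in auto)
qed

section \<open>Units of the monoid of dominant maps\<close>

abbreviation id_map :: "nat \<Rightarrow> nat \<Rightarrow> (point \<rightharpoonup> point)" where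
  "id_map m n \<equiv> (\<lambda>q. if q \<in> phase_space m n then Some q else None)"

lemma dom_id_map: "dom (id_map m n) = phase_space m n"
  by (auto split: if_splits)

lemma total_rat_ext:
  assumes "locally_rational m n F" "dom F = phase_space m n"
  shows "rat_ext m n F = F"
proof -
  have d: "zariski_dense m n (dom F)"
    using assms zariski_dense_phase_space by simp
  show ?thesis
  proof
    fix q
    show "rat_ext m n F q = F q"
    proof (cases "q \<in> phase_space m n")
      case True
      then show ?thesis using rat_ext_extends[OF d assms(1)] assms(2) by (auto simp: map_le_def)
    next
      case False
      then have "rat_ext m n F q = None"
        using locally_rational_dom[OF locally_rational_rat_ext[OF d]] by blast
      moreover have "F q = None" using False assms(2) by blast
      ultimately show ?thesis by simp
    qed
  qed
qed

lemma locally_rational_polyI: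
  assumes "\<And>q p. F q = Some p \<Longrightarrow> q \<in> phase_space m n \<and> p \<in> phase_space m n"
    and "\<And>c. c \<in> block m n \<Longrightarrow> \<exists>f\<in>poly_fun m n. \<forall>q p. F q = Some p \<longrightarrow> p c = f q"
  shows "locally_rational m n F"
  unfolding locally_rational_def
proof (intro allI impI)
  fix q p assume q: "F q = Some p"
  show "regular_value m n F q p"
  proof (rule regular_valueI)
    fix c assume "c \<in> block m n"
    then obtain f where f: "f \<in> poly_fun m n" "\<And>q p. F q = Some p \<Longrightarrow> p c = f q"
      using assms(2) by blast
    show "\<exists>f g. f \<in> poly_fun m n \<and> g \<in> poly_fun m n \<and> g q \<noteq> 0 \<and> p c = f q / g q \<and>
            (\<forall>q' p'. F q' = Some p' \<longrightarrow> g q' \<noteq> 0 \<longrightarrow> p' c = f q' / g q')"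
      by (rule exI[of _ f], rule exI[of _ "\<lambda>_. 1"]) (use f q poly_fun.const in auto)
  qed (use assms(1)[OF q] in auto)
qed

lemma locally_rational_id_map: "locally_rational m n (id_map m n)"
proof (rule locally_rational_polyI)
  fix c assume "c \<in> block m n"
  from poly_fun.coord[OF this]
  show "\<exists>f\<in>poly_fun m n. \<forall>q p. id_map m n q = Some p \<longrightarrow> p c = f q"
    by (rule bexI[rotated]) (simp split: if_splits)
qed (simp split: if_splits)

lemma rat_ext_id_on_dense:
  assumes F: "locally_rational m n F" and S: "zariski_dense m n S" "\<And>q. q \<in> S \<Longrightarrow> F q = Some q"
  shows "rat_ext m n F = id_map m n"
proof -
  let ?I = "\<lambda>q. if q \<in> S then Some q else None"
  have d: "dom ?I = S" by (auto split: if_splits)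
  have "rat_ext m n ?I = rat_ext m n F"
    by (rule rat_ext_dense_sub) (use S F d in \<open>auto simp: map_le_def split: if_splits\<close>)
  moreover have "rat_ext m n ?I = rat_ext m n (id_map m n)"
    by (rule rat_ext_dense_sub)
       (use S d locally_rational_id_map in \<open>auto simp: map_le_def zariski_dense_def split: if_splits\<close>)
  ultimately show ?thesis
    using total_rat_ext[OF locally_rational_id_map dom_id_map] by simp
qed

text \<open>\<open>rat_ext\<close> is defined only where the regular value is unique, and both
  \<open>p\<close> and \<open>q\<close> are regular values at \<open>q\<close>. Uniqueness thus
  comes from the extension being defined rather than from density of \<open>dom F\<close>.\<close>

lemma locally_rational_left_inverse:
  assumes F: "locally_rational m n F" and id: "rat_ext m n F = id_map m n" and q: "F q = Some p"
  shows "p = q"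
proof -
  have r: "regular_value m n F q p" using F q by (simp add: locally_rational_def)
  then have eq: "rat_ext m n F q = Some q" using id regular_value_phase(1) by simp
  then have "\<exists>!p. regular_value m n F q p"
    by (metis (no_types) rat_ext_def option.distinct(1))
  with r rat_ext_regular[OF eq] show ?thesis by blast
qed

text \<open>In a group one would write y = y (h h') = (y h) h' = h'. Here the two cancellations take
  place pointwise, where \<open>h \<circ>\<^sub>m h'\<close> and \<open>y\<close> are both defined;
  what remains is that this set is dense.\<close>

lemma rational_inverse_unique:
  assumes mn: "m \<ge> 1" "n \<ge> 1"
    and rat: "y \<in> rational_maps m n" "h \<in> rational_maps m n" "h' \<in> rational_maps m n"
    and yh: "rat_ext m n (y \<circ>\<^sub>m h) = id_map m n" and hh': "rat_ext m n (h \<circ>\<^sub>m h') = id_map m n"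
  shows "y = h'"
proof -
  note lr = rat[THEN locally_rational_rational_maps]
  let ?D = "dom (h \<circ>\<^sub>m h') \<inter> dom y"
  have agree: "y q = h' q" if "q \<in> ?D" for q
  proof -
    obtain q1 p where q1: "h' q = Some q1" "h q1 = Some p"
      using \<open>q \<in> ?D\<close> by (auto simp: map_comp_Some_iff)
    obtain z where z: "y q = Some z" using \<open>q \<in> ?D\<close> by blast
    have "(h \<circ>\<^sub>m h') q = Some p" using q1 by (simp add: map_comp_def)
    from locally_rational_left_inverse[OF locally_rational_comp[OF lr(2,3)] hh' this] have "p = q" .
    with q1 z have "(y \<circ>\<^sub>m h) q1 = Some z" by (simp add: map_comp_def)
    from locally_rational_left_inverse[OF locally_rational_comp[OF lr(1,2)] yh this] have "z = q1" .
    with q1 z show ?thesis by simp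
  qed
  \<comment> \<open>The extension of the composite is total, and an extension is defined only inside
    the Zariski closure of the original domain.\<close>
  have "zariski_dense m n (dom (h \<circ>\<^sub>m h'))"
    unfolding zariski_dense_def
  proof (intro conjI ballI impI)
    show "dom (h \<circ>\<^sub>m h') \<subseteq> phase_space m n"
      using locally_rational_dom[OF locally_rational_comp[OF lr(2,3)]] .
    fix f q assume "f \<in> poly_fun m n" "\<forall>q\<in>dom (h \<circ>\<^sub>m h'). f q = 0" "q \<in> phase_space m n"
    then show "f q = 0" using rat_ext_in_closure[OF mn, of "h \<circ>\<^sub>m h'" q q f] hh' by auto
  qed
  \<comment> \<open>A dense set is nonempty because the constant 1 does not vanish; around
    \<open>q\<close> the domain of \<open>y\<close> contains an open set, which can be intersected
    with a dense one.\<close>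
  moreover obtain q where q: "q \<in> dom y"
  proof -
    have "\<exists>q. q \<in> dom y"
    proof (rule ccontr)
      assume "\<nexists>q. q \<in> dom y"
      then have "(1::complex) = 0"
        using zariski_denseD[of m n "dom y" "\<lambda>_. 1" "restrict (\<lambda>_. 0) (block m n)"] rat(1)
        by (auto simp: rational_maps_def phase_space_def intro: poly_fun.const)
      then show False by simp
    qed
    then show ?thesis using that by blast
  qed
  then obtain g where g: "g \<in> poly_fun m n" "g q \<noteq> 0"
    "\<And>q'. q' \<in> phase_space m n \<Longrightarrow> g q' \<noteq> 0 \<Longrightarrow> q' \<in> dom y"
    using rational_maps_dom_open[OF rat(1)] by blast
  have qs: "q \<in> phase_space m n" using q locally_rational_dom[OF lr(1)] by blast
  ultimately have "zariski_dense m n {q \<in> dom (h \<circ>\<^sub>m h'). g q \<noteq> 0}"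
    using zariski_dense_inter_nonzero g(1,2) by blast
  then have D: "zariski_dense m n ?D"
    by (rule zariski_dense_mono)
       (use g(3) locally_rational_dom[OF locally_rational_comp[OF lr(2,3)]] in auto)
  have dom_eq: "dom (y |` ?D) = ?D" by auto
  have "y |` ?D \<subseteq>\<^sub>m h'" using agree by (auto simp: map_le_def)
  then have "rat_ext m n (y |` ?D) = rat_ext m n h'"
    by (rule rat_ext_dense_sub) (use D dom_eq lr in auto)
  moreover have "rat_ext m n (y |` ?D) = rat_ext m n y"
    by (rule rat_ext_dense_sub) (use D dom_eq lr in \<open>auto simp: map_le_def\<close>)
  ultimately show ?thesis using rat by (simp add: rational_maps_def)
qed

text \<open>\<open>inv\<close> is a definite description, so exhibiting a two-sided inverse has to
  be accompanied by its uniqueness.\<close>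

lemma Bir_inv:
  assumes mn: "m \<ge> 1" "n \<ge> 1"
    and h: "h \<in> carrier (dominant_monoid m n)" "h' \<in> carrier (dominant_monoid m n)"
    and hh': "rat_ext m n (h \<circ>\<^sub>m h') = id_map m n" and h'h: "rat_ext m n (h' \<circ>\<^sub>m h) = id_map m n"
  shows "inv\<^bsub>Bir m n\<^esub> h = h'"
  unfolding m_inv_def
proof (rule the_equality)
  show "h' \<in> carrier (Bir m n) \<and> h \<otimes>\<^bsub>Bir m n\<^esub> h' = \<one>\<^bsub>Bir m n\<^esub> \<and> h' \<otimes>\<^bsub>Bir m n\<^esub> h = \<one>\<^bsub>Bir m n\<^esub>"
    using h hh' h'h by (auto simp: Bir_def units_of_def Units_def dominant_monoid_def)
next
  fix y assume "y \<in> carrier (Bir m n) \<and> h \<otimes>\<^bsub>Bir m n\<^esub> y = \<one>\<^bsub>Bir m n\<^esub> \<and> y \<otimes>\<^bsub>Bir m n\<^esub> h = \<one>\<^bsub>Bir m n\<^esub>"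
  then have "y \<in> rational_maps m n" "rat_ext m n (y \<circ>\<^sub>m h) = id_map m n"
    by (auto simp: Bir_def units_of_def Units_def dominant_monoid_def)
  then show "y = h'"
    using rational_inverse_unique[OF mn, of y h h'] h hh' by (auto simp: dominant_monoid_def)
qed

section \<open>Maps preserving a polynomial invariant\<close>

definition preserves :: "nat \<Rightarrow> nat \<Rightarrow> (point \<Rightarrow> complex) \<Rightarrow> (point \<rightharpoonup> point) \<Rightarrow> bool" where
  "preserves m n \<Phi> F \<longleftrightarrow>
     (\<forall>q p. F q = Some p \<longrightarrow> q \<in> phase_space m n \<and> p \<in> phase_space m n \<and> \<Phi> p = \<Phi> q)"

lemma preserves_comp:
  "preserves m n \<Phi> F \<Longrightarrow> preserves m n \<Phi> G \<Longrightarrow> preserves m n \<Phi> (F \<circ>\<^sub>m G)"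
  by (fastforce simp: preserves_def map_comp_Some_iff)

text \<open>Writing \<open>\<Phi> p\<close> as a fraction in \<open>q\<close> turns invariance into
  a polynomial equation on \<open>dom F\<close>, and by \<open>rat_ext_in_closure\<close> such an
  equation persists wherever the extension is defined. The domain of \<open>F\<close> is arbitrary,
  so composites are covered as they stand.\<close>

lemma preserves_rat_ext:
  assumes mn: "m \<ge> 1" "n \<ge> 1" and \<Phi>: "\<Phi> \<in> poly_fun m n" and F: "preserves m n \<Phi> F"
  shows "preserves m n \<Phi> (rat_ext m n F)"
  unfolding preserves_def
proof (intro allI impI)
  fix q p assume qp: "rat_ext m n F q = Some p"
  from rat_ext_regular[OF this] have r: "regular_value m n F q p" .
  then obtain f g G where fgG':
    "\<forall>c\<in>block m n. f c \<in> poly_fun m n" "\<forall>c\<in>block m n. g c \<in> poly_fun m n"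
    "G \<in> poly_fun m n" "G q \<noteq> 0" "\<forall>c\<in>block m n. \<forall>q'. G q' \<noteq> 0 \<longrightarrow> g c q' \<noteq> 0"
    "\<forall>c\<in>block m n. p c = f c q / g c q"
    "\<forall>c\<in>block m n. \<forall>q' p'. F q' = Some p' \<longrightarrow> G q' \<noteq> 0 \<longrightarrow> p' c = f c q' / g c q'"
    by (rule regular_valueE)
  note fgG = fgG'[rule_format]
  obtain h k where hk: "h \<in> poly_fun m n" "k \<in> poly_fun m n"
    "\<And>q p. (\<forall>c\<in>block m n. g c q \<noteq> 0 \<and> p c = f c q / g c q) \<Longrightarrow> k q \<noteq> 0 \<and> \<Phi> p = h q / k q"
    using poly_fun_subst[OF \<Phi>, of f g] fgG(1,2) by blast
  have "(\<Phi> q * k q - h q) * G q = 0"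
  proof (rule rat_ext_in_closure[OF mn qp])
    show "(\<lambda>q. (\<Phi> q * k q - h q) * G q) \<in> poly_fun m n"
      by (intro poly_fun.mult poly_fun_diff \<Phi> hk fgG)
    fix x assume "x \<in> dom F"
    then obtain y where y: "F x = Some y" by blast
    show "(\<Phi> x * k x - h x) * G x = 0"
    proof (cases "G x = 0")
      case False
      with y fgG have "\<forall>c\<in>block m n. g c x \<noteq> 0 \<and> y c = f c x / g c x" by blast
      from hk(3)[OF this] have "k x \<noteq> 0" "\<Phi> y = h x / k x" by auto
      moreover have "\<Phi> y = \<Phi> x" using F y by (simp add: preserves_def)
      ultimately show ?thesis by (auto simp: field_simps)
    qed simp
  qed
  moreover have "k q \<noteq> 0 \<and> \<Phi> p = h q / k q"
    by (rule hk(3)) (use fgG in blast)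
  ultimately show "q \<in> phase_space m n \<and> p \<in> phase_space m n \<and> \<Phi> p = \<Phi> q"
    using fgG(4) regular_value_phase[OF r] by (auto simp: field_simps)
qed

text \<open>The inverses among the constructors of \<open>generate\<close> are those of generators;
  inverses of longer words arise as products of these.\<close>

lemma generate_preserves:
  assumes mn: "m \<ge> 1" "n \<ge> 1" and \<Phi>: "\<Phi> \<in> poly_fun m n"
    and H: "\<And>h. h \<in> H \<Longrightarrow> preserves m n \<Phi> h" "\<And>h. h \<in> H \<Longrightarrow> preserves m n \<Phi> (inv\<^bsub>Bir m n\<^esub> h)"
    and w: "w \<in> generate (Bir m n) H"
  shows "preserves m n \<Phi> w"
  using w
proof induction
  case one
  show ?case
    by (auto simp: Bir_def units_of_def dominant_monoid_def preserves_def split: if_splits)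
next
  case (incl h)
  then show ?case by (rule H(1))
next
  case (inv h)
  then show ?case by (rule H(2))
next
  case (eng h1 h2)
  then show ?case
    using preserves_rat_ext[OF mn \<Phi> preserves_comp] by (simp add: Bir_def units_of_def dominant_monoid_def)
qed

section \<open>Permutations of the coordinates\<close>

definition coord_perm :: "nat \<Rightarrow> nat \<Rightarrow> (nat \<times> nat \<Rightarrow> nat \<times> nat) \<Rightarrow> (point \<rightharpoonup> point)" where
  "coord_perm m n \<sigma> = (\<lambda>q. if q \<in> phase_space m n then Some (restrict (q \<circ> \<sigma>) (block m n)) else None)"

lemma dom_coord_perm: "dom (coord_perm m n \<sigma>) = phase_space m n"
  by (auto simp: coord_perm_def split: if_splits)

lemma locally_rational_coord_perm:
  assumes "\<sigma> \<in> block m n \<rightarrow> block m n"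
  shows "locally_rational m n (coord_perm m n \<sigma>)"
proof (rule locally_rational_polyI)
  fix c assume c: "c \<in> block m n"
  then have "\<sigma> c \<in> block m n" using assms by blast
  from poly_fun.coord[OF this]
  show "\<exists>f\<in>poly_fun m n. \<forall>q p. coord_perm m n \<sigma> q = Some p \<longrightarrow> p c = f q"
    by (rule bexI[rotated]) (use c in \<open>auto simp: coord_perm_def split: if_splits\<close>)
qed (auto simp: coord_perm_def phase_space_def split: if_splits)

text \<open>Pulling back reverses the order: the composite reads \<open>q\<close> through
  \<open>\<tau> \<circ> \<sigma>\<close>.\<close>

lemma coord_perm_comp:
  assumes "\<sigma> \<in> block m n \<rightarrow> block m n" "\<And>c. c \<in> block m n \<Longrightarrow> \<tau> (\<sigma> c) = c"
  shows "coord_perm m n \<sigma> \<circ>\<^sub>m coord_perm m n \<tau> = id_map m n"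
proof
  fix q
  show "(coord_perm m n \<sigma> \<circ>\<^sub>m coord_perm m n \<tau>) q = id_map m n q"
  proof (cases "q \<in> phase_space m n")
    case True
    have "restrict (restrict (q \<circ> \<tau>) (block m n) \<circ> \<sigma>) (block m n) = q"
    proof
      fix c
      show "restrict (restrict (q \<circ> \<tau>) (block m n) \<circ> \<sigma>) (block m n) c = q c"
      proof (cases "c \<in> block m n")
        case c: True
        then have "\<sigma> c \<in> block m n" using assms(1) by blast
        then show ?thesis using c assms(2) by simp
      next
        case False
        then show ?thesis
          using PiE_arb[of q "block m n" "\<lambda>_. UNIV" c] True by (simp add: phase_space_def)
      qed
    qed
    then show ?thesis
      using True by (simp add: map_comp_def coord_perm_def phase_space_def)
  qed (simp add: map_comp_def coord_perm_def)
qed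

lemma coord_perm_carrier:
  assumes "\<sigma> \<in> block m n \<rightarrow> block m n" "\<tau> \<in> block m n \<rightarrow> block m n"
    "\<And>c. c \<in> block m n \<Longrightarrow> \<tau> (\<sigma> c) = c"
  shows "coord_perm m n \<sigma> \<in> carrier (dominant_monoid m n)"
proof -
  have "phase_space m n \<subseteq> ran (coord_perm m n \<sigma>)"
  proof
    fix q assume q: "q \<in> phase_space m n"
    then have "(coord_perm m n \<sigma> \<circ>\<^sub>m coord_perm m n \<tau>) q = Some q"
      using coord_perm_comp[OF assms(1,3)] by simp
    then show "q \<in> ran (coord_perm m n \<sigma>)"
      by (auto simp: map_comp_Some_iff ran_def)
  qed
  moreover have "ran (coord_perm m n \<sigma>) \<subseteq> phase_space m n"
    by (auto simp: coord_perm_def ran_def phase_space_def split: if_splits)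
  ultimately have "ran (coord_perm m n \<sigma>) = phase_space m n" by blast
  then show ?thesis
    using total_rat_ext[OF locally_rational_coord_perm[OF assms(1)] dom_coord_perm]
    by (simp add: dominant_monoid_def rational_maps_def dom_coord_perm zariski_dense_phase_space)
qed

text \<open>On the finite block an injective \<open>\<sigma>\<close> is a permutation, so the
  inverse map permutes coordinates too; its invariance is that of \<open>\<sigma>\<close>, applied
  at the image point.\<close>

lemma inv_coord_perm:
  assumes mn: "m \<ge> 1" "n \<ge> 1"
    and \<sigma>: "\<sigma> \<in> block m n \<rightarrow> block m n" "inj_on \<sigma> (block m n)"
    and inv: "preserves m n \<Phi> (coord_perm m n \<sigma>)"
  shows "preserves m n \<Phi> (inv\<^bsub>Bir m n\<^esub> (coord_perm m n \<sigma>))"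
proof -
  have bij: "bij_betw \<sigma> (block m n) (block m n)"
    using \<sigma> finite_block[of m n] by (simp add: bij_betw_def endo_inj_surj image_subset_iff_funcset)
  define \<tau> where "\<tau> = inv_into (block m n) \<sigma>"
  have \<tau>: "\<tau> \<in> block m n \<rightarrow> block m n" "\<And>c. c \<in> block m n \<Longrightarrow> \<tau> (\<sigma> c) = c"
    "\<And>c. c \<in> block m n \<Longrightarrow> \<sigma> (\<tau> c) = c"
    using bij_betw_inv_into_left[OF bij] bij_betw_inv_into_right[OF bij]
      bij_betw_apply[OF bij_betw_inv_into[OF bij]] by (auto simp: \<tau>_def)
  note comp = coord_perm_comp[OF \<sigma>(1) \<tau>(2)] coord_perm_comp[OF \<tau>(1,3)]
  have id: "rat_ext m n (id_map m n) = id_map m n"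
    by (rule total_rat_ext[OF locally_rational_id_map dom_id_map])
  have eq: "inv\<^bsub>Bir m n\<^esub> (coord_perm m n \<sigma>) = coord_perm m n \<tau>"
    by (rule Bir_inv[OF mn coord_perm_carrier[OF \<sigma>(1) \<tau>(1,2)] coord_perm_carrier[OF \<tau>(1) \<sigma>(1) \<tau>(3)]])
       (simp_all add: comp id)
  show ?thesis
    unfolding eq preserves_def
  proof (intro allI impI)
    fix q p assume qp: "coord_perm m n \<tau> q = Some p"
    then have q: "q \<in> phase_space m n" by (auto simp: coord_perm_def split: if_splits)
    then have "(coord_perm m n \<sigma> \<circ>\<^sub>m coord_perm m n \<tau>) q = Some q" by (simp add: comp)
    then have "coord_perm m n \<sigma> p = Some q" using qp by (simp add: map_comp_def)
    then show "q \<in> phase_space m n \<and> p \<in> phase_space m n \<and> \<Phi> p = \<Phi> q"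
      using inv by (simp add: preserves_def)
  qed
qed

section \<open>The geometric R-matrix\<close>

text \<open>Cyclic reading that starts at 0: entry \<open>l\<close> of the vector sits at
  \<open>l - 1\<close>. Rotation becomes addition, and the truncated subtraction in
  \<open>rot\<close> disappears.\<close>

definition cyc :: "nat \<Rightarrow> (nat \<Rightarrow> complex) \<Rightarrow> nat \<Rightarrow> complex" where
  "cyc L a j = a (j mod L + 1)"

lemma cyc_add_L: "cyc L a (j + L) = cyc L a j"
  by (simp add: cyc_def)

lemma mod_Suc_in: "L \<ge> 1 \<Longrightarrow> j mod L + 1 \<in> {1..L}" for j L :: nat
  using mod_less_divisor[of L j] by (simp add: Suc_le_eq)

lemma cyc_pred: "l \<in> {1..L} \<Longrightarrow> cyc L a (l - 1) = a l"
  by (auto simp: cyc_def)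

lemma prod_cyc:
  assumes "L \<ge> 1"
  shows "(\<Prod>j<L. cyc L a (i + j)) = (\<Prod>j=1..L. a j)"
proof (induction i)
  case 0
  have "(\<Prod>j<L. cyc L a j) = (\<Prod>j<L. a (Suc j))"
    by (rule prod.cong) (auto simp: cyc_def)
  then show ?case by (simp add: prod.atLeast1_atMost_eq)
next
  case (Suc i)
  obtain K where K: "L = Suc K" using assms by (cases L) auto
  have "(\<Prod>j<L. cyc L a (Suc i + j)) = (\<Prod>j<K. cyc L a (i + Suc j)) * cyc L a (i + L)"
    by (simp add: K)
  also have "\<dots> = cyc L a (i + 0) * (\<Prod>j<K. cyc L a (i + Suc j))"
    by (simp add: cyc_add_L mult.commute)
  also have "\<dots> = (\<Prod>j<L. cyc L a (i + j))"
    unfolding K by (rule prod.lessThan_Suc_shift[symmetric])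
  finally show ?case using Suc by simp
qed

lemma rot_E_eq:
  "rot_E L a b i = (\<Sum>t<L. (\<Prod>j<t. cyc L b (i + j)) * (\<Prod>j\<in>{t+1..<L}. cyc L a (i + j)))"
  unfolding rot_E_def geom_E_def
proof (rule sum.cong[OF refl])
  fix t assume "t \<in> {..<L}"
  have "(\<Prod>j=1..t. rot L i b j) = (\<Prod>j<t. cyc L b (i + j))"
    by (simp add: prod.atLeast1_atMost_eq rot_def cyc_def)
  moreover have "(\<Prod>j=t+2..L. rot L i a j) = (\<Prod>j\<in>{Suc (t+1)..<Suc L}. rot L i a j)"
    by (rule prod.cong) auto
  moreover have "\<dots> = (\<Prod>j\<in>{t+1..<L}. cyc L a (i + j))"
    unfolding prod.shift_bounds_Suc_ivl by (simp add: rot_def cyc_def)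
  ultimately show "(\<Prod>j=1..t. rot L i b j) * (\<Prod>j=t+2..L. rot L i a j) =
      (\<Prod>j<t. cyc L b (i + j)) * (\<Prod>j\<in>{t+1..<L}. cyc L a (i + j))" by simp
qed

lemma rot_E_add_L: "rot_E L a b (i + L) = rot_E L a b i"
proof -
  have "cyc L c (i + L + j) = cyc L c (i + j)" for c j
    using cyc_add_L[of L c "i + j"] by (simp add: algebra_simps)
  then show ?thesis by (simp add: rot_E_eq)
qed

lemma rot_E_mod: "rot_E L a b (i mod L) = rot_E L a b i"
  by (simp add: rot_E_eq cyc_def mod_add_left_eq)

lemma rot_E_Suc_mod: "rot_E L a b (i mod L + 1) = rot_E L a b (i + 1)"
  using rot_E_mod[of L a b "i mod L + 1"] rot_E_mod[of L a b "i + 1"] by (simp add: mod_Suc_eq)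

lemma rot_E_cong:
  assumes "L \<ge> 1" "\<And>l. l \<in> {1..L} \<Longrightarrow> a l = a' l" "\<And>l. l \<in> {1..L} \<Longrightarrow> b l = b' l"
  shows "rot_E L a b i = rot_E L a' b' i"
proof -
  have "cyc L a = cyc L a'" "cyc L b = cyc L b'"
    using assms(2,3) mod_Suc_in[OF assms(1)] by (simp_all add: cyc_def fun_eq_iff del: atLeastAtMost_iff)
  then show ?thesis by (simp add: rot_E_eq)
qed

text \<open>The two products telescope: their \<open>t\<close>-th and \<open>(t+1)\<close>-st terms are neighbours in one family.\<close>

lemma rot_E_rec:
  assumes "L \<ge> 1"
  shows "cyc L b i * rot_E L a b (i + 1) - cyc L a i * rot_E L a b i
       = (\<Prod>j=1..L. b j) - (\<Prod>j=1..L. a j)"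
proof -
  define g where "g t = (\<Prod>j<t. cyc L b (i + j)) * (\<Prod>j\<in>{t+1..<L+1}. cyc L a (i + j))" for t
  have "cyc L b i * ((\<Prod>j<t. cyc L b (i + 1 + j)) * (\<Prod>j\<in>{t+1..<L}. cyc L a (i + 1 + j))) = g (Suc t)" for t
    using prod.shift_bounds_Suc_ivl[of "\<lambda>j. cyc L a (i + j)" "t + 1" L]
    by (simp add: g_def prod.lessThan_Suc_shift del: prod.lessThan_Suc)
  then have 1: "cyc L b i * rot_E L a b (i + 1) = (\<Sum>t<L. g (Suc t))"
    by (simp only: rot_E_eq sum_distrib_left)
  have "cyc L a i * ((\<Prod>j<t. cyc L b (i + j)) * (\<Prod>j\<in>{t+1..<L}. cyc L a (i + j))) = g t" if "t < L" for t
  proof -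
    \<comment> \<open>Position \<open>L\<close> is the entry at \<open>i\<close> again, so the
      factor \<open>cyc L a i\<close> completes the second product.\<close>
    have "{t+1..<L+1} = insert L {t+1..<L}" using that by auto
    then show ?thesis by (simp add: g_def cyc_add_L)
  qed
  then have 2: "cyc L a i * rot_E L a b i = (\<Sum>t<L. g t)"
    unfolding rot_E_eq sum_distrib_left by (intro sum.cong) auto
  have "g 0 = (\<Prod>j<L. cyc L a (i + 1 + j))"
    using prod.shift_bounds_Suc_ivl[of "\<lambda>j. cyc L a (i + j)" 0 L]
    by (simp add: g_def atLeast0LessThan)
  moreover have "g L = (\<Prod>j<L. cyc L b (i + j))" by (simp add: g_def)
  ultimately show ?thesis
    unfolding 1 2 sum_subtractf[symmetric] sum_lessThan_telescope
    using prod_cyc[OF assms, of b i] prod_cyc[OF assms, of a "i + 1"] by simp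
qed

lemma geom_R_prod:
  assumes "geom_R_defined L a b" "l \<in> {1..L}"
  shows "fst (geom_R L a b) l * snd (geom_R L a b) l = a l * b l"
proof -
  have "rot_E L a b l \<noteq> 0" "rot_E L a b (l - 1) \<noteq> 0"
    using assms by (auto simp: geom_R_defined_def)
  then show ?thesis by (simp add: geom_R_def)
qed

text \<open>The recursion at \<open>l\<close> turns the first term into
  \<open>a (l mod L + 1) + ?X / ?E l\<close>, and the recursion at \<open>l - 1\<close> turns the
  second into \<open>b l - ?X / ?E l\<close>.\<close>

lemma geom_R_sum:
  assumes d: "geom_R_defined L a b" and l: "l \<in> {1..L}"
  shows "fst (geom_R L a b) (l mod L + 1) + snd (geom_R L a b) l = a (l mod L + 1) + b l"
proof -
  let ?E = "rot_E L a b" and ?X = "(\<Prod>j=1..L. b j) - (\<Prod>j=1..L. a j)"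
  have L: "L \<ge> 1" using l by auto
  have nz: "?E l \<noteq> 0" using d l by (auto simp: geom_R_defined_def)
  have 1: "b l * ?E l - a l * ?E (l - 1) = ?X"
    using rot_E_rec[OF L, of b "l - 1" a, unfolded cyc_pred[OF l]] l by simp
  have 2: "b (l mod L + 1) * ?E (l + 1) - a (l mod L + 1) * ?E l = ?X"
    using rot_E_rec[OF L, of b l a] by (simp add: cyc_def)
  have "fst (geom_R L a b) (l mod L + 1) = b (l mod L + 1) * ?E (l + 1) / ?E l"
    by (simp only: geom_R_def fst_conv rot_E_Suc_mod rot_E_mod add_diff_cancel_right')
  also have "\<dots> = (?X + a (l mod L + 1) * ?E l) / ?E l" using 2 by (simp add: algebra_simps)
  finally have 3: "fst (geom_R L a b) (l mod L + 1) = (?X + a (l mod L + 1) * ?E l) / ?E l" .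
  have "snd (geom_R L a b) l = (b l * ?E l - ?X) / ?E l"
    using 1 by (simp add: geom_R_def algebra_simps)
  with 3 nz show ?thesis by (simp add: diff_divide_distrib add_divide_distrib)
qed

text \<open>Telescoping around the cycle. It yields that R preserves the product of all
  \<open>a\<close> and the product of all \<open>b\<close>.\<close>

lemma prod_ratio_cyclic:
  fixes a e :: "nat \<Rightarrow> complex"
  assumes "\<And>i. i \<in> {0..L} \<Longrightarrow> e i \<noteq> 0" "e L = e 0"
  shows "(\<Prod>l=1..L. a l * e (l - 1) / e l) = (\<Prod>l=1..L. a l)"
    and "(\<Prod>l=1..L. a l * e l / e (l - 1)) = (\<Prod>l=1..L. a l)"
proof -
  have *: "K \<le> L \<Longrightarrow> (\<Prod>l=1..K. a l * e (l - 1) / e l) * e K = (\<Prod>l=1..K. a l) * e 0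
     \<and> (\<Prod>l=1..K. a l * e l / e (l - 1)) * e 0 = (\<Prod>l=1..K. a l) * e K" for K
  proof (induction K)
    case (Suc K)
    then show ?case using assms(1)[of K] assms(1)[of "Suc K"] by (auto simp: field_simps)
  qed simp
  show "(\<Prod>l=1..L. a l * e (l - 1) / e l) = (\<Prod>l=1..L. a l)"
    "(\<Prod>l=1..L. a l * e l / e (l - 1)) = (\<Prod>l=1..L. a l)"
    using *[of L] assms by auto
qed

text \<open>Two applications of R cancel once \<open>?E'\<close> equals \<open>?E\<close>. Both
  solve the same first-order recursion, so the difference \<open>\<delta>\<close> solves the
  homogeneous one; a full turn around the cycle multiplies \<open>\<delta>\<close> by the product of
  \<open>a\<close> on one side and of \<open>b\<close> on the other, and \<open>ne\<close> forces it
  to vanish.\<close>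

lemma geom_R_involution:
  assumes L: "L \<ge> 1" and d: "geom_R_defined L a b" and ne: "(\<Prod>j=1..L. a j) \<noteq> (\<Prod>j=1..L. b j)"
    and b': "\<And>l. l \<in> {1..L} \<Longrightarrow> b' l = fst (geom_R L a b) l"
    and a': "\<And>l. l \<in> {1..L} \<Longrightarrow> a' l = snd (geom_R L a b) l"
  shows "geom_R_defined L b' a'"
    and "l \<in> {1..L} \<Longrightarrow> fst (geom_R L b' a') l = a l"
    and "l \<in> {1..L} \<Longrightarrow> snd (geom_R L b' a') l = b l"
proof -
  let ?E = "rot_E L a b" and ?E' = "rot_E L b' a'"
  have nz: "?E i \<noteq> 0" for i
    using d L mod_less_divisor[of L i] rot_E_mod[of L a b i] by (auto simp: geom_R_defined_def)
  have per: "?E L = ?E 0" using rot_E_add_L[of L a b 0] by simp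
  have a'_eq: "a' l = a l * ?E (l - 1) / ?E l" and b'_eq: "b' l = b l * ?E l / ?E (l - 1)"
    if "l \<in> {1..L}" for l
    using a'[OF that] b'[OF that] by (simp_all add: geom_R_def)
  have pa: "(\<Prod>j=1..L. a' j) = (\<Prod>j=1..L. a j)" and pb: "(\<Prod>j=1..L. b' j) = (\<Prod>j=1..L. b j)"
    using prod_ratio_cyclic[of L ?E] nz per a'_eq b'_eq by simp_all
  define \<delta> where "\<delta> i = ?E' i - ?E i" for i
  have step: "cyc L a' i * \<delta> (Suc i) = cyc L b' i * \<delta> i" for i
  proof -
    have s: "i mod L + 1 \<in> {1..L}" using mod_Suc_in[OF L] .
    \<comment> \<open>The defining ratios of R convert the recursion of \<open>?E\<close> for the
      old pair into the one that \<open>?E'\<close> satisfies for the new pair.\<close>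
    have "cyc L a' i * ?E (i + 1) = cyc L a i * ?E i" "cyc L b' i * ?E i = cyc L b i * ?E (i + 1)"
      using a'_eq[OF s] b'_eq[OF s] nz[of i] nz[of "i + 1"]
      by (simp_all only: cyc_def rot_E_Suc_mod rot_E_mod add_diff_cancel_right') (simp_all add: field_simps)
    then have "cyc L a' i * \<delta> (Suc i) - cyc L b' i * \<delta> i
        = (cyc L a' i * ?E' (i + 1) - cyc L b' i * ?E' i) + (cyc L b i * ?E (i + 1) - cyc L a i * ?E i)"
      by (simp add: \<delta>_def algebra_simps)
    also have "\<dots> = 0"
      using rot_E_rec[OF L, of b i a] rot_E_rec[OF L, of a' i b'] pa pb by simp
    finally show ?thesis by simp
  qed
  have "(\<Prod>j<T. cyc L a' (i + j)) * \<delta> (i + T) = (\<Prod>j<T. cyc L b' (i + j)) * \<delta> i" for i T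
  proof (induction T)
    case (Suc T)
    have "(\<Prod>j<Suc T. cyc L a' (i + j)) * \<delta> (i + Suc T)
        = (\<Prod>j<T. cyc L a' (i + j)) * (cyc L a' (i + T) * \<delta> (Suc (i + T)))" by simp
    also have "\<dots> = cyc L b' (i + T) * ((\<Prod>j<T. cyc L a' (i + j)) * \<delta> (i + T))"
      unfolding step by simp
    also have "\<dots> = (\<Prod>j<Suc T. cyc L b' (i + j)) * \<delta> i" unfolding Suc.IH by simp
    finally show ?case .
  qed simp
  from this[of _ L] have "(\<Prod>j=1..L. a j) * \<delta> i = (\<Prod>j=1..L. b j) * \<delta> i" for i
    unfolding prod_cyc[OF L] pa pb by (simp only: \<delta>_def rot_E_add_L)
  then have "\<delta> i = 0" for i using ne by simp
  then have E': "?E' i = ?E i" for i by (simp add: \<delta>_def)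
  show "geom_R_defined L b' a'" by (simp add: geom_R_defined_def E' nz)
  show "fst (geom_R L b' a') l = a l" if "l \<in> {1..L}"
    using nz[of l] nz[of "l - 1"] by (simp add: geom_R_def E' a'_eq[OF that])
  show "snd (geom_R L b' a') l = b l" if "l \<in> {1..L}"
    using nz[of l] nz[of "l - 1"] by (simp add: geom_R_def E' b'_eq[OF that])
qed

section \<open>The R-matrix as a rational map\<close>

lemma poly_fun_rot_E:
  assumes "L \<ge> 1" "u \<in> {1..L} \<rightarrow> block m n" "v \<in> {1..L} \<rightarrow> block m n"
  shows "(\<lambda>q. rot_E L (\<lambda>l. q (u l)) (\<lambda>l. q (v l)) i) \<in> poly_fun m n"
proof -
  have "(\<lambda>q. cyc L (\<lambda>l. q (u l)) j) \<in> poly_fun m n" "(\<lambda>q. cyc L (\<lambda>l. q (v l)) j) \<in> poly_fun m n" for j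
    unfolding cyc_def using assms(2,3) mod_Suc_in[OF assms(1)]
    by (intro poly_fun.coord; blast)+
  then show ?thesis
    unfolding rot_E_eq by (intro poly_fun_sum poly_fun.mult poly_fun_prod)
qed

text \<open>Common form of the row and the column generators: \<open>u\<close> and \<open>v\<close>
  list the positions of the two vectors, so that rationality and invertibility are proved once for
  both.\<close>

definition swap_map ::
  "nat \<Rightarrow> nat \<Rightarrow> nat \<Rightarrow> (nat \<Rightarrow> nat \<times> nat) \<Rightarrow> (nat \<Rightarrow> nat \<times> nat) \<Rightarrow> (point \<rightharpoonup> point)" where
  "swap_map m n L u v = (\<lambda>q.
     let a = (\<lambda>l. q (u l)); b = (\<lambda>l. q (v l)) in
     if q \<in> phase_space m n \<and> geom_R_defined L a b
     then Some (restrict (\<lambda>c.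
            if c \<in> u ` {1..L} then fst (geom_R L a b) (inv_into {1..L} u c)
            else if c \<in> v ` {1..L} then snd (geom_R L a b) (inv_into {1..L} v c)
            else q c) (block m n))
     else None)"

locale R_positions =
  fixes m n L :: nat and u v :: "nat \<Rightarrow> nat \<times> nat"
  assumes mn: "m \<ge> 1" "n \<ge> 1" and L: "L \<ge> 1"
    and uv: "u \<in> {1..L} \<rightarrow> block m n" "v \<in> {1..L} \<rightarrow> block m n"
    and inj: "inj_on u {1..L}" "inj_on v {1..L}"
    and disj: "u ` {1..L} \<inter> v ` {1..L} = {}"
begin

abbreviation "R q \<equiv> geom_R L (\<lambda>l. q (u l)) (\<lambda>l. q (v l))"

text \<open>Disposes of \<open>inv_into\<close>: injectivity and disjointness of the positions make
  the prescription unambiguous, and any \<open>p\<close> with these coordinates is the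
  value.\<close>

lemma swap_map_iff:
  "swap_map m n L u v q = Some p \<longleftrightarrow>
     q \<in> phase_space m n \<and> geom_R_defined L (\<lambda>l. q (u l)) (\<lambda>l. q (v l)) \<and> p \<in> phase_space m n \<and>
     (\<forall>l\<in>{1..L}. p (u l) = fst (R q) l) \<and> (\<forall>l\<in>{1..L}. p (v l) = snd (R q) l) \<and>
     (\<forall>c\<in>block m n - u ` {1..L} - v ` {1..L}. p c = q c)"
proof -
  let ?w = "restrict (\<lambda>c. if c \<in> u ` {1..L} then fst (R q) (inv_into {1..L} u c)
            else if c \<in> v ` {1..L} then snd (R q) (inv_into {1..L} v c) else q c) (block m n)"
  have wu: "?w (u l) = fst (R q) l" if "l \<in> {1..L}" for l
    using that uv inj by (auto simp: Pi_iff)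
  have wv: "?w (v l) = snd (R q) l" if "l \<in> {1..L}" for l
  proof -
    have "v l \<notin> u ` {1..L}" using that disj by blast
    then show ?thesis using that uv inj by (auto simp: Pi_iff)
  qed
  have wc: "?w c = q c" if "c \<in> block m n - u ` {1..L} - v ` {1..L}" for c
    using that by simp
  have ws: "?w \<in> phase_space m n" unfolding phase_space_def by (intro restrict_PiE_iff[THEN iffD2]) simp
  have "p = ?w" if p: "p \<in> phase_space m n" "\<forall>l\<in>{1..L}. p (u l) = fst (R q) l"
    "\<forall>l\<in>{1..L}. p (v l) = snd (R q) l" "\<forall>c\<in>block m n - u ` {1..L} - v ` {1..L}. p c = q c"
  proof -
    have "p c = ?w c" if "c \<in> block m n" for c
    proof -
      consider l where "l \<in> {1..L}" "c = u l" | l where "l \<in> {1..L}" "c = v l"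
        | "c \<in> block m n - u ` {1..L} - v ` {1..L}"
        using \<open>c \<in> block m n\<close> by blast
      then show ?thesis
      proof cases
        case 1
        then show ?thesis using wu p(2) by simp
      next
        case 2
        then show ?thesis using wv p(3) by simp
      next
        case 3
        then show ?thesis using wc p(4) by simp
      qed
    qed
    then show ?thesis
      using PiE_ext[of p "block m n" "\<lambda>_. UNIV" ?w] p(1) ws unfolding phase_space_def by blast
  qed
  then show ?thesis
    using wu wv wc ws unfolding swap_map_def Let_def by auto
qed

lemma swap_map_block_cases:
  assumes "c \<in> block m n"
  obtains l where "l \<in> {1..L}" "c = u l" | l where "l \<in> {1..L}" "c = v l"
    | "c \<in> block m n - u ` {1..L} - v ` {1..L}"
  using assms by blast

lemma locally_rational_swap_map: "locally_rational m n (swap_map m n L u v)"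
  unfolding locally_rational_def
proof (intro allI impI)
  fix q p assume qp: "swap_map m n L u v q = Some p"
  note E = poly_fun_rot_E[OF L uv]
  let ?E = "\<lambda>i q. rot_E L (\<lambda>l. q (u l)) (\<lambda>l. q (v l)) i"
  show "regular_value m n (swap_map m n L u v) q p"
  proof (rule regular_valueI)
    fix c assume "c \<in> block m n"
    then show "\<exists>f g. f \<in> poly_fun m n \<and> g \<in> poly_fun m n \<and> g q \<noteq> 0 \<and> p c = f q / g q \<and>
      (\<forall>q' p'. swap_map m n L u v q' = Some p' \<longrightarrow> g q' \<noteq> 0 \<longrightarrow> p' c = f q' / g q')"
    proof (cases rule: swap_map_block_cases)
      case (1 l)
      have "(\<lambda>q. q (v l)) \<in> poly_fun m n" using 1 uv by (intro poly_fun.coord) auto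
      with 1 E qp show ?thesis
        by (intro exI[of _ "\<lambda>q. q (v l) * ?E l q"] exI[of _ "?E (l - 1)"])
           (auto simp: swap_map_iff geom_R_def geom_R_defined_def intro!: poly_fun.mult)
    next
      case (2 l)
      have "(\<lambda>q. q (u l)) \<in> poly_fun m n" using 2 uv by (intro poly_fun.coord) auto
      with 2 E qp show ?thesis
        by (intro exI[of _ "\<lambda>q. q (u l) * ?E (l - 1) q"] exI[of _ "?E l"])
           (auto simp: swap_map_iff geom_R_def geom_R_defined_def intro!: poly_fun.mult)
    next
      case 3
      have "(\<lambda>q. q c) \<in> poly_fun m n" using 3 by (intro poly_fun.coord) auto
      with 3 qp show ?thesis
        by (intro exI[of _ "\<lambda>q. q c"] exI[of _ "\<lambda>_. 1"])
           (auto simp: swap_map_iff intro: poly_fun.const)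
    qed
  qed (use qp in \<open>auto simp: swap_map_iff\<close>)
qed

lemma swap_map_involution:
  assumes "swap_map m n L u v q = Some p" "(\<Prod>l=1..L. q (u l)) \<noteq> (\<Prod>l=1..L. q (v l))"
  shows "swap_map m n L u v p = Some q"
  using assms(1) geom_R_involution[OF L _ assms(2), of "\<lambda>l. p (u l)" "\<lambda>l. p (v l)"]
  unfolding swap_map_iff by auto

text \<open>Nonzero exactly where R is defined and \<open>geom_R_involution\<close> applies.\<close>

definition generic :: "point \<Rightarrow> complex" where
  "generic q = (\<Prod>i\<in>{0..L}. rot_E L (\<lambda>l. q (u l)) (\<lambda>l. q (v l)) i) *
     ((\<Prod>l=1..L. q (u l)) - (\<Prod>l=1..L. q (v l)))"

lemma generic_poly: "generic \<in> poly_fun m n"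
proof -
  have "(\<lambda>q. q (u l)) \<in> poly_fun m n" "(\<lambda>q. q (v l)) \<in> poly_fun m n" if "l \<in> {1..L}" for l
    using that uv by (auto intro!: poly_fun.coord)
  then have "(\<lambda>q. generic q) \<in> poly_fun m n"
    unfolding generic_def
    by (intro poly_fun.mult poly_fun_diff poly_fun_prod poly_fun_rot_E[OF L uv]) auto
  then show ?thesis by simp
qed

lemma generic_dense: "zariski_dense m n {q \<in> phase_space m n. generic q \<noteq> 0}"
proof (rule zariski_dense_nonzero[OF generic_poly])
  \<comment> \<open>Entries 1 at the positions \<open>u\<close> and 2 at the positions
    \<open>v\<close>: every E becomes the positive integer \<open>\<Sum>t<L. 2 ^ t\<close>, and the
    two products are 1 and \<open>2 ^ L\<close>.\<close>
  define q0 where "q0 = restrict (\<lambda>c. if c \<in> v ` {1..L} then 2 else 1 :: complex) (block m n)"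
  show "q0 \<in> phase_space m n" by (auto simp: q0_def phase_space_def)
  have q0: "q0 (u l) = 1" "q0 (v l) = 2" if "l \<in> {1..L}" for l
  proof -
    have "u l \<notin> v ` {1..L}" "u l \<in> block m n" "v l \<in> block m n"
      using that uv disj by blast+
    then show "q0 (u l) = 1" "q0 (v l) = 2" using that by (auto simp: q0_def)
  qed
  have "rot_E L (\<lambda>l. q0 (u l)) (\<lambda>l. q0 (v l)) i = of_nat (\<Sum>t<L. 2 ^ t)" for i
  proof -
    have "rot_E L (\<lambda>l. q0 (u l)) (\<lambda>l. q0 (v l)) i = rot_E L (\<lambda>_. 1) (\<lambda>_. 2) i"
      by (rule rot_E_cong[OF L]) (simp_all add: q0)
    then show ?thesis by (simp add: rot_E_eq cyc_def)
  qed
  moreover have "(\<Sum>t<L. 2 ^ t) \<noteq> (0::nat)" using L by (auto intro!: exI[of _ 0])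
  ultimately have E0: "rot_E L (\<lambda>l. q0 (u l)) (\<lambda>l. q0 (v l)) i \<noteq> 0" for i
    by (simp only: of_nat_eq_0_iff not_False_eq_True)
  have "2 ^ L \<noteq> (1::complex)"
  proof
    assume "2 ^ L = (1::complex)"
    then have "of_nat (2 ^ L) = (of_nat 1 :: complex)" by simp
    then have "2 ^ L = (1::nat)" unfolding of_nat_eq_iff .
    then show False using L by simp
  qed
  then show "generic q0 \<noteq> 0"
    using E0 by (auto simp: generic_def q0)
qed

lemma swap_map_generic:
  assumes "q \<in> phase_space m n" "generic q \<noteq> 0"
  obtains p where "swap_map m n L u v q = Some p" "swap_map m n L u v p = Some q"
proof -
  have "geom_R_defined L (\<lambda>l. q (u l)) (\<lambda>l. q (v l))" "(\<Prod>l=1..L. q (u l)) \<noteq> (\<Prod>l=1..L. q (v l))"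
    using assms(2) by (auto simp: generic_def geom_R_defined_def)
  moreover from this obtain p where "swap_map m n L u v q = Some p"
    using assms(1) by (auto simp: swap_map_def Let_def)
  ultimately show ?thesis using that swap_map_involution by blast
qed

text \<open>Generic points lie in the range and return to themselves after two applications. The
  first fact gives dominance, the second makes the square the identity of rational maps.\<close>

lemma swap_map_inverse:
  "inv\<^bsub>Bir m n\<^esub> (rat_ext m n (swap_map m n L u v)) = rat_ext m n (swap_map m n L u v)"
proof -
  let ?F = "swap_map m n L u v"
  let ?S = "rat_ext m n ?F"
  have "zariski_dense m n (dom ?F)"
    by (rule zariski_dense_mono[OF generic_dense _ locally_rational_dom[OF locally_rational_swap_map]])
       (use swap_map_generic in blast)
  note ext = rat_ext_extends[OF this locally_rational_swap_map]
    and lr = locally_rational_rat_ext[OF this]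
    and rat = rational_maps_rat_ext[OF this locally_rational_swap_map]
  have inv: "\<exists>p. ?S q = Some p \<and> ?S p = Some q" if q: "q \<in> phase_space m n" "generic q \<noteq> 0" for q
  proof -
    obtain p where "?F q = Some p" "?F p = Some q" using q by (rule swap_map_generic)
    then show ?thesis using ext by (metis domI map_le_def)
  qed
  have "zariski_dense m n (ran ?S)"
  proof (rule zariski_dense_mono[OF generic_dense])
    show "{q \<in> phase_space m n. generic q \<noteq> 0} \<subseteq> ran ?S"
      using inv by (force simp: ran_def)
    show "ran ?S \<subseteq> phase_space m n"
      using rat_ext_regular regular_value_phase(2) by (force simp: ran_def)
  qed
  with rat have carrier: "?S \<in> carrier (dominant_monoid m n)" by (simp add: dominant_monoid_def)
  have "rat_ext m n (?S \<circ>\<^sub>m ?S) = id_map m n"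
    by (rule rat_ext_id_on_dense[OF locally_rational_comp[OF lr lr] generic_dense])
       (use inv in \<open>force simp: map_comp_def\<close>)
  then show ?thesis by (intro Bir_inv[OF mn carrier carrier])
qed

end

section \<open>Lax matrices\<close>

abbreviation cst :: "complex \<Rightarrow> complex poly poly" where
  "cst c \<equiv> [:[:c:]:]"

lemma lax_mat_carrier [simp]: "lax_mat n d \<in> carrier_mat n n"
  by (simp add: lax_mat_def)

lemma P_mat_carrier [simp]: "P_mat n \<in> carrier_mat n n"
  by (simp add: P_mat_def)

lemma Q_mat_carrier [simp]: "Q_mat n q i \<in> carrier_mat n n"
  by (simp add: Q_mat_def)

lemma P_pow_carrier [simp]: "P_mat n ^\<^sub>m k \<in> carrier_mat n n"
  by (simp add: pow_carrier_mat)

lemmas lax_dims [simp] =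
  carrier_matD[OF lax_mat_carrier] carrier_matD[OF P_mat_carrier] carrier_matD[OF Q_mat_carrier]

lemma lax_mat_index:
  "i < n \<Longrightarrow> j < n \<Longrightarrow> lax_mat n d $$ (i, j) = (if i = j then cst (d (i + 1)) else if i = j + 1 then 1
     else if i = 0 \<and> j = n - 1 then var_x else 0)"
  by (simp add: lax_mat_def)

text \<open>For \<open>n \<ge> 2\<close> a row has two entries that can be nonzero, in different
  columns: the diagonal one and its cyclic left neighbour, which is \<open>var_x\<close> in row
  0.\<close>

lemma lax_mat_row_sum:
  assumes "n \<ge> 2" "i < n"
  shows "(\<Sum>k = 0..<n. lax_mat n d $$ (i, k) * f k) =
    cst (d (i + 1)) * f i + (if i = 0 then var_x * f (n - 1) else f (i - 1))"
proof -
  let ?k = "if i = 0 then n - 1 else i - 1"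
  have "(\<Sum>k = 0..<n. lax_mat n d $$ (i, k) * f k) =
     (\<Sum>k = 0..<n. (if k = i then cst (d (i + 1)) * f i else 0) +
        (if k = ?k then (if i = 0 then var_x else 1) * f k else 0))"
    by (rule sum.cong) (use assms in \<open>auto simp: lax_mat_def\<close>)
  also have "\<dots> = cst (d (i + 1)) * f i + (if i = 0 then var_x else 1) * f ?k"
    using assms by (auto simp: sum.distrib)
  finally show ?thesis by simp
qed

lemma lax_mat_mult:
  assumes "n \<ge> 2" "B \<in> carrier_mat n n" "i < n" "j < n"
  shows "(lax_mat n d * B) $$ (i, j) =
    cst (d (i + 1)) * B $$ (i, j) + (if i = 0 then var_x * B $$ (n - 1, j) else B $$ (i - 1, j))"
proof -
  have "(lax_mat n d * B) $$ (i, j) = (\<Sum>k = 0..<n. lax_mat n d $$ (i, k) * B $$ (k, j))"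
    using assms carrier_matD[OF assms(2)] by (simp add: scalar_prod_def)
  then show ?thesis using lax_mat_row_sum[OF assms(1,3), of d "\<lambda>k. B $$ (k, j)"] by simp
qed

lemma P_mat_mult:
  assumes "n \<ge> 2" "B \<in> carrier_mat n n" "i < n" "j < n"
  shows "(P_mat n * B) $$ (i, j) = (if i = 0 then var_x * B $$ (n - 1, j) else B $$ (i - 1, j))"
  unfolding P_mat_def by (subst lax_mat_mult[OF assms]) simp

text \<open>Left multiplication by \<open>P_mat n\<close> shifts the rows down cyclically, with a
  factor \<open>var_x\<close> for each wrap; as \<open>k \<le> n\<close>, no row wraps more than
  once.\<close>

lemma P_pow_mult:
  assumes "n \<ge> 2" "B \<in> carrier_mat n n" "i < n" "j < n" "k \<le> n"
  shows "(P_mat n ^\<^sub>m k * B) $$ (i, j) =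
    (if i < k then var_x * B $$ (i + n - k, j) else B $$ (i - k, j))"
  using assms(2,5)
proof (induction k arbitrary: B)
  case 0
  then show ?case using assms by (simp add: left_mult_one_mat)
next
  case (Suc k)
  have PB: "P_mat n * B \<in> carrier_mat n n" using Suc.prems by (simp add: mult_carrier_mat[of _ n n])
  have eq: "P_mat n ^\<^sub>m Suc k * B = P_mat n ^\<^sub>m k * (P_mat n * B)"
    using Suc.prems by (simp add: assoc_mult_mat[of _ n n _ n _ n])
  have P: "(P_mat n * B) $$ (a, j) = (if a = 0 then var_x * B $$ (n - 1, j) else B $$ (a - 1, j))"
    if "a < n" for a
    by (rule P_mat_mult[OF assms(1) Suc.prems(1) that assms(4)])
  have k: "k \<le> n" "k < n" using Suc.prems by auto
  consider "i < k" | "i = k" | "k < i" by linarith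
  then show ?case
  proof cases
    case 1
    then show ?thesis unfolding eq Suc.IH[OF PB k(1)] using P[of "i + n - k"] assms(3) k(2) by simp
  next
    case 2
    then show ?thesis unfolding eq Suc.IH[OF PB k(1)] using P[of 0] k(2) by simp
  next
    case 3
    then show ?thesis unfolding eq Suc.IH[OF PB k(1)] using P[of "i - k"] assms(3) by simp
  qed
qed

lemma P_pow_index:
  assumes "n \<ge> 2" "i < n" "j < n" "k \<le> n"
  shows "(P_mat n ^\<^sub>m k) $$ (i, j) =
    (if i < k then (if i + n - k = j then var_x else 0) else (if i - k = j then 1 else 0))"
proof -
  have "P_mat n ^\<^sub>m k = P_mat n ^\<^sub>m k * 1\<^sub>m n"
    using right_mult_one_mat[OF P_pow_carrier] by metis
  then show ?thesis
    using P_pow_mult[OF assms(1) one_carrier_mat assms(2-4)] assms by auto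
qed

text \<open>The rows below the top express every entry of a kernel vector as a constant times its
  last entry. The top row then multiplies the last entry by a polynomial of degree one in x, which
  forces it to vanish.\<close>

lemma det_lax_mat_nonzero:
  assumes n: "n \<ge> 2"
  shows "det (lax_mat n d) \<noteq> 0"
proof
  assume "det (lax_mat n d) = 0"
  then obtain v where v: "v \<in> carrier_vec n" "v \<noteq> 0\<^sub>v n" "lax_mat n d *\<^sub>v v = 0\<^sub>v n"
    using det_0_iff_vec_prod_zero[OF lax_mat_carrier] by blast
  have eq: "cst (d (i + 1)) * v $ i + (if i = 0 then var_x * v $ (n - 1) else v $ (i - 1)) = 0" if "i < n" for i
  proof -
    have "(lax_mat n d *\<^sub>v v) $ i = (\<Sum>k = 0..<n. lax_mat n d $$ (i, k) * v $ k)"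
      using that carrier_vecD[OF v(1)] by (simp add: scalar_prod_def)
    then show ?thesis using lax_mat_row_sum[OF n that, of d "\<lambda>k. v $ k"] v(3) that by simp
  qed
  have multiple: "s < n \<Longrightarrow> \<exists>c. v $ (n - 1 - s) = cst c * v $ (n - 1)" for s
  proof (induction s)
    case 0
    show ?case by (rule exI[of _ 1]) (simp add: one_pCons[symmetric])
  next
    case (Suc s)
    then obtain c where c: "v $ (n - 1 - s) = cst c * v $ (n - 1)" by auto
    have "cst (d (n - 1 - s + 1)) * v $ (n - 1 - s) + v $ (n - 1 - Suc s) = 0"
      using eq[of "n - 1 - s"] Suc.prems by simp
    then have "v $ (n - 1 - Suc s) = - (cst (d (n - 1 - s + 1)) * (cst c * v $ (n - 1)))"
      unfolding c by (simp add: eq_neg_iff_add_eq_0 add.commute)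
    also have "\<dots> = cst (- (d (n - 1 - s + 1) * c)) * v $ (n - 1)"
      by (simp add: mult.assoc[symmetric] smult_minus_left[symmetric] del: smult_minus_left)
    finally show ?case by blast
  qed
  obtain c where c: "v $ 0 = cst c * v $ (n - 1)" using multiple[of "n - 1"] n by auto
  have "cst (d 1) * (cst c * v $ (n - 1)) + var_x * v $ (n - 1) = 0"
    using eq[of 0] n c by simp
  then have "[:[:d 1 * c, 1:]:] * v $ (n - 1) = 0"
    by (simp add: mult.assoc[symmetric] smult_add_left[symmetric])
  then have "v $ (n - 1) = 0"
    by (metis mult_eq_0_iff pCons_eq_0_iff zero_neq_one)
  have "v = 0\<^sub>v n"
  proof (rule eq_vecI)
    fix i assume "i < dim_vec (0\<^sub>v n :: complex poly poly vec)"
    then have "i < n" by simp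
    then show "v $ i = 0\<^sub>v n $ i"
      using multiple[of "n - 1 - i"] \<open>v $ (n - 1) = 0\<close> by auto
  qed (use v in simp)
  with v(2) show False by contradiction
qed

text \<open>Conjugation without an inverse: \<open>T\<close> may fail to be invertible over the
  polynomial ring, but its determinant cancels in an integral domain. This matters for
  \<open>lax_mat\<close>, whose determinant involves x.\<close>

lemma det_sub_var_intertwine:
  fixes A B T :: "complex poly poly mat"
  assumes c: "A \<in> carrier_mat n n" "B \<in> carrier_mat n n" "T \<in> carrier_mat n n"
    and AT: "A * T = T * B" and T: "det T \<noteq> 0"
  shows "det (A - var_y \<cdot>\<^sub>m 1\<^sub>m n) = det (B - var_y \<cdot>\<^sub>m 1\<^sub>m n)"
proof -
  let ?y = "var_y \<cdot>\<^sub>m 1\<^sub>m n"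
  have y: "?y \<in> carrier_mat n n" by simp
  have "?y * T = var_y \<cdot>\<^sub>m T" "T * ?y = var_y \<cdot>\<^sub>m T"
    using c(3) mult_smult_distrib[OF c(3) one_carrier_mat, of var_y]
      mult_smult_assoc_mat[OF one_carrier_mat c(3), of var_y] by simp_all
  then have "(A - ?y) * T = T * (B - ?y)"
    using minus_mult_distrib_mat[OF c(1) y c(3)] mult_minus_distrib_mat[OF c(3,2) y] AT by simp
  then have "det (A - ?y) * det T = det T * det (B - ?y)"
    by (simp only: det_mult[OF minus_carrier_mat[OF y] c(3), of A, symmetric]
        det_mult[OF c(3) minus_carrier_mat[OF y], of B, symmetric])
  then show ?thesis using T by simp
qed

text \<open>Folds onto an arbitrary right factor, so that lists split under \<open>@\<close> and
  \<open>P_mat n ^\<^sub>m k\<close> can be carried along as the last factor.\<close>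

definition lax_prod :: "nat \<Rightarrow> point \<Rightarrow> nat list \<Rightarrow> complex poly poly mat \<Rightarrow> complex poly poly mat" where
  "lax_prod n q is X = foldr (\<lambda>i A. Q_mat n q i * A) is X"

lemma lax_prod_simps [simp]:
  "lax_prod n q [] X = X"
  "lax_prod n q (i # is) X = Q_mat n q i * lax_prod n q is X"
  "lax_prod n q (is @ js) X = lax_prod n q is (lax_prod n q js X)"
  by (simp_all add: lax_prod_def)

lemma lax_prod_carrier [simp]:
  "X \<in> carrier_mat n n \<Longrightarrow> lax_prod n q is X \<in> carrier_mat n n"
  by (induction "is") (auto intro: mult_carrier_mat[of _ n n])

lemma lax_prod_mult:
  assumes "X \<in> carrier_mat n n" "Y \<in> carrier_mat n n"
  shows "lax_prod n q is (X * Y) = lax_prod n q is X * Y"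
proof (induction "is")
  case (Cons i "is")
  then show ?case
    using assms assoc_mult_mat[of "Q_mat n q i" n n "lax_prod n q is X" n Y n] by simp
qed simp

lemma lax_prod_cong:
  assumes "\<And>i j. i \<in> set is \<Longrightarrow> j \<in> {1..n} \<Longrightarrow> q (i, j) = q' (i, j)"
  shows "lax_prod n q is X = lax_prod n q' is X"
  using assms
proof (induction "is")
  case (Cons i "is")
  have "Q_mat n q i = Q_mat n q' i"
    unfolding Q_mat_def lax_mat_def by (rule cong_mat) (use Cons.prems in auto)
  then show ?case using Cons by simp
qed simp

lemma psi_eq: "psi m n k q = det (lax_prod n q [1..<m + 1] (P_mat n ^\<^sub>m k) - var_y \<cdot>\<^sub>m 1\<^sub>m n)"
proof -
  have "lax_prod n q [1..<m + 1] (1\<^sub>m n) * (P_mat n ^\<^sub>m k) = lax_prod n q [1..<m + 1] (P_mat n ^\<^sub>m k)"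
    using lax_prod_mult[of "1\<^sub>m n" n "P_mat n ^\<^sub>m k" q "[1..<m + 1]", symmetric]
      left_mult_one_mat[OF P_pow_carrier[of n k]] by (simp del: upt_Suc)
  then show ?thesis by (simp add: psi_def lax_prod_def)
qed

section \<open>Invariance under the generators\<close>

text \<open>The parameters enter the product only through \<open>a j * b j\<close> on the diagonal
  and \<open>a (j mod n + 1) + b j\<close> one step below it, cyclically and with a factor
  \<open>var_x\<close> in the corner.\<close>

lemma lax_mat_mult_eqI:
  assumes n: "n \<ge> 2"
    and prod: "\<And>j. j \<in> {1..n} \<Longrightarrow> a j * b j = a' j * b' j"
    and sum: "\<And>j. j \<in> {1..n} \<Longrightarrow> a (j mod n + 1) + b j = a' (j mod n + 1) + b' j"
  shows "lax_mat n a * lax_mat n b = lax_mat n a' * lax_mat n b'"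
proof (rule eq_matI)
  fix i j assume "i < dim_row (lax_mat n a' * lax_mat n b')" "j < dim_col (lax_mat n a' * lax_mat n b')"
  then have ij: "i < n" "j < n" by simp_all
  note e = lax_mat_index
  have lm: "(lax_mat n a * lax_mat n b) $$ (i, j) = cst (a (i + 1)) * lax_mat n b $$ (i, j) +
     (if i = 0 then var_x * lax_mat n b $$ (n - 1, j) else lax_mat n b $$ (i - 1, j))" for a b
    by (rule lax_mat_mult[OF n lax_mat_carrier ij])
  consider "i = j" | "i = j + 1" | "i = 0" "j = n - 1" | "i \<noteq> j" "i \<noteq> j + 1" "\<not> (i = 0 \<and> j = n - 1)"
    by blast
  then show "(lax_mat n a * lax_mat n b) $$ (i, j) = (lax_mat n a' * lax_mat n b') $$ (i, j)"
  proof cases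
    case 1
    then show ?thesis using prod[of "i + 1"] ij n unfolding lm by (auto simp: e)
  next
    case 2
    then show ?thesis using sum[of "j + 1"] ij n unfolding lm by (auto simp: e)
  next
    case 3
    have "cst (a 1) * var_x + var_x * cst (b n) = cst (a 1 + b n) * var_x" for a b :: "nat \<Rightarrow> complex"
      by (simp add: algebra_simps)
    then show ?thesis using 3 sum[of n] ij n unfolding lm by (simp add: e)
  next
    case 4
    then show ?thesis using ij n unfolding lm by (auto simp: e)
  qed
qed simp_all

lemma psi_row_swap:
  assumes n: "n \<ge> 2" and r: "r \<in> {1..m - 1}"
    and other: "\<And>i j. i \<in> {1..m} \<Longrightarrow> i \<noteq> r \<Longrightarrow> i \<noteq> r + 1 \<Longrightarrow> j \<in> {1..n} \<Longrightarrow> p (i, j) = q (i, j)"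
    and prod: "\<And>j. j \<in> {1..n} \<Longrightarrow> p (r, j) * p (r + 1, j) = q (r, j) * q (r + 1, j)"
    and sum: "\<And>j. j \<in> {1..n} \<Longrightarrow> p (r, j mod n + 1) + p (r + 1, j) = q (r, j mod n + 1) + q (r + 1, j)"
  shows "psi m n k p = psi m n k q"
proof -
  let ?P = "P_mat n ^\<^sub>m k"
  have split: "[1..<m + 1] = [1..<r] @ [r, r + 1] @ [r + 2..<m + 1]"
  proof -
    have "[1..<m + 1] = [1..<r] @ [r..<m + 1]"
      using r upt_add_eq_append[of 1 r "m + 1 - r"] by auto
    moreover have "[r..<m + 1] = [r, r + 1] @ [r + 2..<m + 1]"
      using r by (auto simp: upt_conv_Cons simp del: upt_Suc)
    ultimately show ?thesis by simp
  qed
  have QQ: "Q_mat n p r * Q_mat n p (r + 1) = Q_mat n q r * Q_mat n q (r + 1)"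
    unfolding Q_mat_def by (rule lax_mat_mult_eqI[OF n]) (erule prod, erule sum)
  have "lax_prod n p [1..<m + 1] ?P = lax_prod n p [1..<r] (Q_mat n p r * Q_mat n p (r + 1) * lax_prod n p [r + 2..<m + 1] ?P)"
    unfolding split by (simp add: assoc_mult_mat[of _ n n _ n _ n] del: upt_Suc)
  also have "\<dots> = lax_prod n q [1..<r] (Q_mat n q r * Q_mat n q (r + 1) * lax_prod n q [r + 2..<m + 1] ?P)"
  proof -
    have "lax_prod n p [r + 2..<m + 1] ?P = lax_prod n q [r + 2..<m + 1] ?P"
      by (rule lax_prod_cong) (use other r in auto)
    moreover have "lax_prod n p [1..<r] X = lax_prod n q [1..<r] X" for X
      by (rule lax_prod_cong) (use other r in auto)
    ultimately show ?thesis by (simp only: QQ)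
  qed
  also have "\<dots> = lax_prod n q [1..<m + 1] ?P"
    unfolding split by (simp add: assoc_mult_mat[of _ n n _ n _ n] del: upt_Suc)
  finally show ?thesis by (simp only: psi_eq)
qed

text \<open>Moving \<open>P_mat n ^\<^sub>m k\<close> past the last factor for \<open>p\<close>
  shifts the diagonal by \<open>k\<close> and produces \<open>?Q\<close>, the first factor for
  \<open>q\<close>. The two products are then \<open>Z * ?Q\<close> and
  \<open>?Q * Z\<close>.\<close>

lemma psi_row_rotate:
  assumes n: "n \<ge> 2" and m: "m \<ge> 1" and k: "k \<le> n"
    and row: "\<And>i j. i \<in> {1..<m} \<Longrightarrow> j \<in> {1..n} \<Longrightarrow> p (i, j) = q (i + 1, j)"
    and last: "\<And>j. j \<in> {1..n} \<Longrightarrow> p (m, j) = q (1, if j \<le> k then j + n - k else j - k)"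
  shows "psi m n k p = psi m n k q"
proof -
  let ?P = "P_mat n ^\<^sub>m k" and ?Q = "Q_mat n q 1"
  have PQ: "Q_mat n p m * ?P = ?P * ?Q"
  proof (rule eq_matI)
    fix i j assume "i < dim_row (?P * ?Q)" "j < dim_col (?P * ?Q)"
    then have ij: "i < n" "j < n" using carrier_matD[OF P_pow_carrier[of n k]] by simp_all
    have e: "Q_mat n q r $$ (i, j) = (if i = j then cst (q (r, i + 1)) else if i = j + 1 then 1
     else if i = 0 \<and> j = n - 1 then var_x else 0)" if "i < n" "j < n" for r i j
      using that by (simp add: Q_mat_def lax_mat_index)
    have l: "(Q_mat n p m * ?P) $$ (i, j) = cst (p (m, i + 1)) * ?P $$ (i, j) +
        (if i = 0 then var_x * ?P $$ (n - 1, j) else ?P $$ (i - 1, j))"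
      unfolding Q_mat_def by (rule lax_mat_mult[OF n P_pow_carrier ij])
    have r: "(?P * ?Q) $$ (i, j) = (if i < k then var_x * ?Q $$ (i + n - k, j) else ?Q $$ (i - k, j))"
      by (rule P_pow_mult[OF n Q_mat_carrier ij k])
    have last': "p (m, Suc i) = q (1, if i < k then Suc i + n - k else Suc i - k)"
      using last[of "Suc i"] ij by (simp add: Suc_le_eq)
    show "(Q_mat n p m * ?P) $$ (i, j) = (?P * ?Q) $$ (i, j)"
    proof -
      \<comment> \<open>The cases record which rows wrap around; \<open>k = n\<close> stands apart
        because \<open>P_mat n ^\<^sub>m n\<close> is \<open>var_x\<close> times the
        identity.\<close>
      consider "i = 0" "k = n" | "i = 0" "0 < k" "k < n" | "0 < i" "i < k" | "i = k" "k < n" | "k < i"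
        using ij k by linarith
      then show ?thesis
      proof cases
        case 1
        then show ?thesis unfolding l r using n k ij last' by (auto simp: P_pow_index e Suc_diff_le)
      next
        case 2
        then show ?thesis unfolding l r using n k ij last' by (auto simp: P_pow_index e Suc_diff_le)
      next
        case 3
        then show ?thesis unfolding l r using n k ij last' by (auto simp: P_pow_index e Suc_diff_le)
      next
        case 4
        then show ?thesis unfolding l r using n k ij last' by (auto simp: P_pow_index e Suc_diff_le)
      next
        case 5
        then show ?thesis unfolding l r using n k ij last' by (auto simp: P_pow_index e Suc_diff_le)
      qed
    qed
  qed (simp_all add: carrier_matD[OF P_pow_carrier[of n k]])
  define Z where "Z = lax_prod n p [1..<m] ?P"
  have Z: "Z \<in> carrier_mat n n" by (simp add: Z_def)
  have Zq: "lax_prod n q [2..<m + 1] X = lax_prod n p [1..<m] X" if "X \<in> carrier_mat n n" for X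
  proof -
    have "[2..<m + 1] = map Suc [1..<m]" by (simp add: map_Suc_upt numeral_2_eq_2)
    moreover have "lax_prod n q (map Suc is) X = lax_prod n p is X" if "set is \<subseteq> {1..<m}" for "is"
      using that
    proof (induction "is")
      case (Cons i "is")
      have "Q_mat n q (Suc i) = Q_mat n p i"
        unfolding Q_mat_def lax_mat_def by (rule cong_mat) (use row Cons.prems in auto)
      then show ?case using Cons by simp
    qed simp
    ultimately show ?thesis by simp
  qed
  have "[1..<m + 1] = [1..<m] @ [m]" using m by simp
  then have Mp: "lax_prod n p [1..<m + 1] ?P = Z * ?Q"
    by (simp add: PQ lax_prod_mult Z_def del: upt_Suc)
  have "[1..<m + 1] = 1 # [2..<m + 1]" using m by (simp add: upt_conv_Cons numeral_2_eq_2 del: upt_Suc)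
  then have Mq: "lax_prod n q [1..<m + 1] ?P = ?Q * Z"
    using Zq[of ?P] by (simp add: Z_def del: upt_Suc)
  have "?Q * Z * ?Q = ?Q * (Z * ?Q)" using Z by (simp add: assoc_mult_mat[of _ n n _ n _ n])
  then have "det (?Q * Z - var_y \<cdot>\<^sub>m 1\<^sub>m n) = det (Z * ?Q - var_y \<cdot>\<^sub>m 1\<^sub>m n)"
    by (rule det_sub_var_intertwine[rotated 3])
       (use Z det_lax_mat_nonzero[OF n] in \<open>simp_all add: mult_carrier_mat[of _ n n] Q_mat_def\<close>)
  then show ?thesis by (simp only: psi_eq Mp Mq)
qed

text \<open>Telescoping: \<open>PT\<close> carries \<open>T 1\<close> across the power of
  \<open>P_mat n\<close> as \<open>T (m + 1)\<close>, each \<open>QT\<close> moves it one factor to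
  the left, and \<open>T 1\<close> comes out in front. Column rotation uses a constant
  \<open>T\<close>, column swaps a varying one.\<close>

lemma psi_intertwine:
  assumes T: "\<And>i. T i \<in> carrier_mat n n" "det (T 1) \<noteq> 0"
    and QT: "\<And>i. i \<in> {1..m} \<Longrightarrow> Q_mat n p i * T (i + 1) = T i * Q_mat n q i"
    and PT: "T (m + 1) * P_mat n ^\<^sub>m k = P_mat n ^\<^sub>m k * T 1"
  shows "psi m n k p = psi m n k q"
proof -
  let ?P = "P_mat n ^\<^sub>m k"
  have "l \<le> m \<Longrightarrow> lax_prod n p [m + 1 - l..<m + 1] (T (m + 1) * ?P) = T (m + 1 - l) * lax_prod n q [m + 1 - l..<m + 1] ?P" for l
  proof (induction l)
    case (Suc l)
    let ?i = "m - l"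
    have i: "?i \<in> {1..m}" "m + 1 - l = ?i + 1" "m + 1 - Suc l = ?i" using Suc.prems by auto
    have s: "[?i..<m + 1] = ?i # [?i + 1..<m + 1]" by (simp add: upt_conv_Cons del: upt_Suc)
    have "lax_prod n p [?i..<m + 1] (T (m + 1) * ?P) = Q_mat n p ?i * (T (?i + 1) * lax_prod n q [?i + 1..<m + 1] ?P)"
      unfolding s using Suc i by (simp del: upt_Suc)
    also have "\<dots> = Q_mat n p ?i * T (?i + 1) * lax_prod n q [?i + 1..<m + 1] ?P"
      by (rule assoc_mult_mat[of _ n n _ n _ n, symmetric]) (simp_all add: T del: upt_Suc)
    also have "\<dots> = T ?i * (Q_mat n q ?i * lax_prod n q [?i + 1..<m + 1] ?P)"
      unfolding QT[OF i(1)] by (rule assoc_mult_mat[of _ n n _ n _ n]) (simp_all add: T del: upt_Suc)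
    finally show ?case unfolding i(3) s by (simp del: upt_Suc)
  qed simp
  from this[of m] have "lax_prod n p [1..<m + 1] ?P * T 1 = T 1 * lax_prod n q [1..<m + 1] ?P"
    unfolding PT lax_prod_mult[OF P_pow_carrier T(1)] by (simp del: upt_Suc)
  then show ?thesis
    unfolding psi_eq by (rule det_sub_var_intertwine[rotated 3]) (simp_all add: T del: upt_Suc One_nat_def)
qed

lemma psi_column_rotate:
  assumes n: "n \<ge> 2"
    and p: "\<And>i j. i \<in> {1..m} \<Longrightarrow> j \<in> {1..n} \<Longrightarrow> p (i, j) = q (i, if j = 1 then n else j - 1)"
  shows "psi m n k p = psi m n k q"
proof (rule psi_intertwine[where T = "\<lambda>_. P_mat n"])
  show "Q_mat n p i * P_mat n = P_mat n * Q_mat n q i" if "i \<in> {1..m}" for i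
  proof (rule eq_matI)
    fix a b assume "a < dim_row (P_mat n * Q_mat n q i)" "b < dim_col (P_mat n * Q_mat n q i)"
    then have ab: "a < n" "b < n" by simp_all
    note e = lax_mat_index
    have "p (i, a + 1) = q (i, if a = 0 then n else a)" using p[OF that, of "a + 1"] ab by auto
    then show "(Q_mat n p i * P_mat n) $$ (a, b) = (P_mat n * Q_mat n q i) $$ (a, b)"
      using ab n unfolding Q_mat_def P_mat_def
      by (subst (1 2) lax_mat_mult) (auto simp: e)
  qed simp_all
  show "P_mat n * P_mat n ^\<^sub>m k = P_mat n ^\<^sub>m k * P_mat n"
  proof (induction k)
    case (Suc k)
    then show ?case
      using assoc_mult_mat[of "P_mat n" n n "P_mat n ^\<^sub>m k" n "P_mat n" n] by simp
  qed (use left_mult_one_mat[OF P_mat_carrier] right_mult_one_mat[OF P_mat_carrier] in simp)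
  show "det (P_mat n) \<noteq> 0" unfolding P_mat_def by (rule det_lax_mat_nonzero[OF n])
qed (use n in simp_all)

definition shear_mat :: "nat \<Rightarrow> (nat \<Rightarrow> complex) \<Rightarrow> complex poly poly mat" where
  "shear_mat n t = Matrix.mat n n (\<lambda>(i, j). if i = j then 1 else if j = i + 1 then cst (t (i + 1)) else 0)"

lemma shear_mat_carrier [simp]: "shear_mat n t \<in> carrier_mat n n"
  by (simp add: shear_mat_def)

lemmas shear_dims [simp] = carrier_matD[OF shear_mat_carrier]

lemma det_shear_mat: "det (shear_mat n t) = 1"
proof -
  have "det (shear_mat n t) = prod_list (diag_mat (shear_mat n t))"
    by (rule det_upper_triangular[of _ n]) (auto simp: shear_mat_def intro!: upper_triangularI)
  also have "diag_mat (shear_mat n t) = map (\<lambda>_. 1) [0..<n]"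
    by (auto simp: diag_mat_def shear_mat_def)
  also have "prod_list \<dots> = 1" by (induction n) auto
  finally show ?thesis .
qed

lemma shear_mat_mult:
  assumes "B \<in> carrier_mat n n" "i < n" "j < n"
  shows "(shear_mat n t * B) $$ (i, j) =
    B $$ (i, j) + (if i + 1 < n then cst (t (i + 1)) * B $$ (i + 1, j) else 0)"
proof -
  have "(shear_mat n t * B) $$ (i, j) = (\<Sum>k = 0..<n. shear_mat n t $$ (i, k) * B $$ (k, j))"
    using assms carrier_matD[OF assms(1)] by (simp add: scalar_prod_def)
  also have "\<dots> = (\<Sum>k = 0..<n. (if k = i then B $$ (i, j) else 0) +
        (if k = i + 1 then cst (t (i + 1)) * B $$ (i + 1, j) else 0))"
    by (rule sum.cong) (use assms in \<open>auto simp: shear_mat_def\<close>)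
  also have "\<dots> = B $$ (i, j) + (if i + 1 < n then cst (t (i + 1)) * B $$ (i + 1, j) else 0)"
    using assms by (simp add: sum.distrib sum.delta)
  finally show ?thesis .
qed

text \<open>\<open>diag\<close> and \<open>off\<close> are the diagonal and superdiagonal entries of
  the intertwining relation, \<open>t0\<close> removes the terms at the two ends of the diagonal,
  and \<open>per\<close> is compatibility with \<open>P_mat n ^\<^sub>m k\<close>.\<close>

lemma psi_shear:
  assumes n: "n \<ge> 2" and k: "k \<le> n"
    and diag: "\<And>i j. i \<in> {1..m} \<Longrightarrow> j \<in> {1..n} \<Longrightarrow> p (i, j) + t (i + 1) (j - 1) = q (i, j) + t i j"
    and off: "\<And>i j. i \<in> {1..m} \<Longrightarrow> j \<in> {1..<n} \<Longrightarrow> p (i, j) * t (i + 1) j = t i j * q (i, j + 1)"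
    and t0: "\<And>i. t i 0 = 0" "\<And>i. t i n = 0"
    and per: "\<And>j. j \<in> {1..n} \<Longrightarrow> t (m + 1) j = (if j \<le> k then t 1 (j + n - k) else t 1 (j - k))"
  shows "psi m n k p = psi m n k q"
proof (rule psi_intertwine[where T = "\<lambda>i. shear_mat n (t i)"])
  note e = lax_mat_index
  have s: "shear_mat n d $$ (a, b) = (if a = b then 1 else if b = a + 1 then cst (d (a + 1)) else 0)"
    if "a < n" "b < n" for a b d
    using that by (simp add: shear_mat_def)
  show "Q_mat n p i * shear_mat n (t (i + 1)) = shear_mat n (t i) * Q_mat n q i" if i: "i \<in> {1..m}" for i
  proof (rule eq_matI)
    fix a b assume "a < dim_row (shear_mat n (t i) * Q_mat n q i)" "b < dim_col (shear_mat n (t i) * Q_mat n q i)"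
    then have ab: "a < n" "b < n" by simp_all
    have L: "(Q_mat n p i * shear_mat n (t (i + 1))) $$ (a, b) = cst (p (i, a + 1)) * shear_mat n (t (i + 1)) $$ (a, b) +
      (if a = 0 then var_x * shear_mat n (t (i + 1)) $$ (n - 1, b) else shear_mat n (t (i + 1)) $$ (a - 1, b))"
      unfolding Q_mat_def by (rule lax_mat_mult[OF n shear_mat_carrier ab])
    have R: "(shear_mat n (t i) * Q_mat n q i) $$ (a, b) = Q_mat n q i $$ (a, b) +
      (if a + 1 < n then cst (t i (a + 1)) * Q_mat n q i $$ (a + 1, b) else 0)"
      by (rule shear_mat_mult[OF Q_mat_carrier ab])
    have d: "p (i, a + 1) + t (i + 1) a = q (i, a + 1) + t i (a + 1)" using diag[OF i, of "a + 1"] ab by simp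
    consider "b = a" | "b = a + 1" | "b \<noteq> a" "b \<noteq> a + 1" by blast
    then show "(Q_mat n p i * shear_mat n (t (i + 1))) $$ (a, b) = (shear_mat n (t i) * Q_mat n q i) $$ (a, b)"
    proof cases
      case 1
      have "t i (a + 1) = 0" if "\<not> a + 1 < n"
      proof -
        have "a + 1 = n" using that ab by simp
        then show ?thesis using t0(2)[of i] by simp
      qed
      then show ?thesis
        unfolding L R using 1 ab n d t0(1)[of "i + 1"]
        by (cases "a = 0") (auto simp: Q_mat_def e s)
    next
      case 2
      then show ?thesis
        unfolding L R using ab n off[OF i, of "a + 1"]
        by (auto simp: Q_mat_def e s)
    next
      case 3
      then show ?thesis unfolding L R using ab n by (auto simp: Q_mat_def e s)
    qed
  qed simp_all
  show "shear_mat n (t (m + 1)) * P_mat n ^\<^sub>m k = P_mat n ^\<^sub>m k * shear_mat n (t 1)"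
  proof (rule eq_matI)
    fix a b assume "a < dim_row (P_mat n ^\<^sub>m k * shear_mat n (t 1))" "b < dim_col (P_mat n ^\<^sub>m k * shear_mat n (t 1))"
    then have ab: "a < n" "b < n" using carrier_matD[OF P_pow_carrier[of n k]] by simp_all
    have 1: "(shear_mat n (t (m + 1)) * P_mat n ^\<^sub>m k) $$ (a, b) = (P_mat n ^\<^sub>m k) $$ (a, b) +
      (if a + 1 < n then cst (t (m + 1) (a + 1)) * (P_mat n ^\<^sub>m k) $$ (a + 1, b) else 0)"
      by (rule shear_mat_mult[OF P_pow_carrier ab])
    have 2: "(P_mat n ^\<^sub>m k * shear_mat n (t 1)) $$ (a, b) =
      (if a < k then var_x * shear_mat n (t 1) $$ (a + n - k, b) else shear_mat n (t 1) $$ (a - k, b))"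
      by (rule P_pow_mult[OF n shear_mat_carrier ab k])
    have p: "t (m + 1) (Suc a) = (if Suc a \<le> k then t 1 (Suc a + n - k) else t 1 (Suc a - k))" if "a + 1 < n"
      using per[of "Suc a"] that by simp
    \<comment> \<open>In rows \<open>n - 1\<close> and \<open>k - 1\<close> a superdiagonal entry
      appears on one side only; \<open>per\<close> together with \<open>t0\<close> makes it
      zero.\<close>
    have pn: "t 1 (Suc (n - Suc k)) = 0" if "k < n"
      using per[of n] that t0 n by (simp add: Suc_diff_Suc)
    have pk: "t (m + 1) k = 0" if "k < n" "k > 0" using per[of k] that t0 by simp
    show "(shear_mat n (t (m + 1)) * P_mat n ^\<^sub>m k) $$ (a, b) = (P_mat n ^\<^sub>m k * shear_mat n (t 1)) $$ (a, b)"
    proof (cases "a + 1 < n")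
      case True
      consider "a + 1 < k" | "a + 1 = k" | "k \<le> a" by linarith
      then show ?thesis
      proof cases
        case x: 1
        then show ?thesis unfolding 1 2 using True ab n k p by (auto simp: P_pow_index s Suc_diff_le)
      next
        case x: 2
        then show ?thesis unfolding 1 2 using True ab n k pk by (auto simp: P_pow_index s)
      next
        case x: 3
        then show ?thesis unfolding 1 2 using True ab n k p by (auto simp: P_pow_index s Suc_diff_le)
      qed
    next
      case False
      then have "a = n - 1" using ab by simp
      then show ?thesis unfolding 1 2 using n k pn ab by (auto simp: P_pow_index s Suc_diff_le)
    qed
  qed (simp_all add: carrier_matD[OF P_pow_carrier[of n k]])
qed (use n in \<open>simp_all add: det_shear_mat\<close>)

section \<open>The coefficients of the spectral polynomial\<close>

text \<open>The extension argument concerns complex-valued polynomial functions, so a function with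
  values in the polynomial ring enters through its coefficients.\<close>

definition poly_coeffs :: "nat \<Rightarrow> nat \<Rightarrow> (point \<Rightarrow> complex poly poly) \<Rightarrow> bool" where
  "poly_coeffs m n F \<longleftrightarrow> (\<forall>a b. (\<lambda>q. coeff (coeff (F q) b) a) \<in> poly_fun m n)"

lemma poly_coeffs_const: "poly_coeffs m n (\<lambda>q. c)"
  by (simp add: poly_coeffs_def poly_fun.const)

lemma poly_coeffs_add:
  "poly_coeffs m n F \<Longrightarrow> poly_coeffs m n G \<Longrightarrow> poly_coeffs m n (\<lambda>q. F q + G q)"
  by (simp add: poly_coeffs_def poly_fun.add)

lemma poly_coeffs_mult:
  assumes "poly_coeffs m n F" "poly_coeffs m n G"
  shows "poly_coeffs m n (\<lambda>q. F q * G q)"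
  unfolding poly_coeffs_def
proof (intro allI)
  fix a b
  have "(\<lambda>q. \<Sum>i\<le>b. \<Sum>j\<le>a. coeff (coeff (F q) i) j * coeff (coeff (G q) (b - i)) (a - j)) \<in> poly_fun m n"
    using assms unfolding poly_coeffs_def by (intro poly_fun_sum poly_fun.mult) auto
  then show "(\<lambda>q. coeff (coeff (F q * G q) b) a) \<in> poly_fun m n"
    by (simp add: coeff_mult coeff_sum)
qed

lemma poly_coeffs_cst:
  assumes "f \<in> poly_fun m n"
  shows "poly_coeffs m n (\<lambda>q. cst (f q))"
  unfolding poly_coeffs_def
proof (intro allI)
  fix a b
  show "(\<lambda>q. coeff (coeff (cst (f q)) b) a) \<in> poly_fun m n"
    by (cases a; cases b) (simp_all add: assms poly_fun.const)
qed

lemma poly_coeffs_prod: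
  "(\<And>x. x \<in> A \<Longrightarrow> poly_coeffs m n (F x)) \<Longrightarrow> poly_coeffs m n (\<lambda>q. \<Prod>x\<in>A. F x q)"
  by (induction A rule: infinite_finite_induct) (simp_all add: poly_coeffs_const poly_coeffs_mult)

lemma poly_coeffs_sum:
  "(\<And>x. x \<in> A \<Longrightarrow> poly_coeffs m n (F x)) \<Longrightarrow> poly_coeffs m n (\<lambda>q. \<Sum>x\<in>A. F x q)"
  by (induction A rule: infinite_finite_induct) (simp_all add: poly_coeffs_const poly_coeffs_add)

lemma poly_coeffs_lax_prod:
  assumes n: "n \<ge> 2" and X: "X \<in> carrier_mat n n"
    and "set is \<subseteq> {1..m}" "i < n" "j < n"
  shows "poly_coeffs m n (\<lambda>q. lax_prod n q is X $$ (i, j))"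
  using assms(3-5)
proof (induction "is" arbitrary: i)
  case Nil
  then show ?case by (simp add: poly_coeffs_const)
next
  case (Cons r "is")
  have eq: "lax_prod n q (r # is) X $$ (i, j) = cst (q (r, i + 1)) * lax_prod n q is X $$ (i, j) +
    (if i = 0 then var_x else 1) * lax_prod n q is X $$ (if i = 0 then n - 1 else i - 1, j)" for q
  proof -
    have "lax_prod n q (r # is) X = lax_mat n (\<lambda>j. q (r, j)) * lax_prod n q is X"
      by (simp add: Q_mat_def)
    then show ?thesis
      using lax_mat_mult[OF n lax_prod_carrier[OF X] Cons.prems(2,3)] by simp
  qed
  have "(r, i + 1) \<in> block m n" using Cons.prems by (auto simp: block_def)
  then have "poly_coeffs m n (\<lambda>q. cst (q (r, i + 1)))"
    by (intro poly_coeffs_cst poly_fun.coord)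
  moreover have "poly_coeffs m n (\<lambda>q. lax_prod n q is X $$ (i', j))" if "i' < n" for i'
    using Cons that by simp
  ultimately show ?case
    unfolding eq using Cons.prems n by (intro poly_coeffs_add poly_coeffs_mult poly_coeffs_const) auto
qed

lemma poly_coeffs_psi:
  assumes n: "n \<ge> 2"
  shows "poly_coeffs m n (psi m n k)"
proof -
  let ?M = "\<lambda>q. lax_prod n q [1..<m + 1] (P_mat n ^\<^sub>m k)"
  let ?Y = "var_y \<cdot>\<^sub>m 1\<^sub>m n"
  have eq: "psi m n k q = (\<Sum>\<sigma> | \<sigma> permutes {0..<n}. signof \<sigma> *
      (\<Prod>i = 0..<n. ?M q $$ (i, \<sigma> i) + - (?Y $$ (i, \<sigma> i))))" for q
  proof -
    have c: "?M q - ?Y \<in> carrier_mat n n" by (intro minus_carrier_mat) simp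
    have "(?M q - ?Y) $$ (i, \<sigma> i) = ?M q $$ (i, \<sigma> i) + - (?Y $$ (i, \<sigma> i))"
      if "\<sigma> permutes {0..<n}" "i \<in> {0..<n}" for \<sigma> i
      using that permutes_in_image[OF that(1), of i] by (simp del: upt_Suc)
    then show ?thesis
      unfolding psi_eq det_def'[OF c] by (intro sum.cong refl arg_cong2[of _ _ _ _ "(*)"] prod.cong) auto
  qed
  have "poly_coeffs m n (\<lambda>q. \<Sum>\<sigma> | \<sigma> permutes {0..<n}. signof \<sigma> *
      (\<Prod>i = 0..<n. ?M q $$ (i, \<sigma> i) + - (?Y $$ (i, \<sigma> i))))"
    by (intro poly_coeffs_sum poly_coeffs_mult poly_coeffs_prod poly_coeffs_add poly_coeffs_const
        poly_coeffs_lax_prod[OF n P_pow_carrier]) (auto dest: permutes_in_image)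
  then show ?thesis by (simp add: eq[abs_def])
qed

section \<open>Positions in the extended array\<close>

text \<open>The representative in the block of (i, j) modulo the lattice spanned by (m, k) and (0,
  n).\<close>

definition ext_pos :: "nat \<Rightarrow> nat \<Rightarrow> nat \<Rightarrow> int \<Rightarrow> int \<Rightarrow> nat \<times> nat" where
  "ext_pos m n k i j =
     (nat ((i - 1) mod int m + 1), nat ((j - int k * ((i - 1) div int m) - 1) mod int n + 1))"

lemma ext_eq: "ext m n k q i j = q (ext_pos m n k i j)"
  by (simp add: ext_def ext_pos_def)

lemma ext_pos_in_block:
  assumes "m \<ge> 1" "n \<ge> 1"
  shows "ext_pos m n k i j \<in> block m n"
proof -
  have "0 \<le> x mod int l" "x mod int l < int l" if "l \<ge> 1" for x l
    using that by simp_all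
  from this[OF assms(1)] this[OF assms(2)] show ?thesis
    by (simp add: ext_pos_def block_def nat_le_iff le_nat_iff add1_zle_eq)
qed

lemma ext_pos_of_block:
  assumes "(i, j) \<in> block m n"
  shows "ext_pos m n k (int i) (int j) = (i, j)"
proof -
  have "(int i - 1) mod int m = int i - 1" "(int i - 1) div int m = 0" "(int j - 1) mod int n = int j - 1"
    using assms by (auto simp: block_def)
  then show ?thesis by (simp add: ext_pos_def)
qed

lemma ext_pos_shift:
  assumes "m \<ge> 1"
  shows "ext_pos m n k (i + s * int m) (j + s * int k + t * int n) = ext_pos m n k i j"
proof -
  have i: "i + s * int m - 1 = (i - 1) + s * int m" by simp
  have 1: "(i + s * int m - 1) mod int m = (i - 1) mod int m" unfolding i by simp
  have 2: "(i + s * int m - 1) div int m = (i - 1) div int m + s"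
    unfolding i using assms by (simp add: add.commute)
  have "j + s * int k + t * int n - int k * ((i - 1) div int m + s) - 1
      = (j - int k * ((i - 1) div int m) - 1) + t * int n" by (simp add: algebra_simps)
  then have 3: "(j + s * int k + t * int n - int k * ((i - 1) div int m + s) - 1) mod int n
      = (j - int k * ((i - 1) div int m) - 1) mod int n" by (simp only: mod_mult_self1)
  show ?thesis unfolding ext_pos_def 1 2 3 ..
qed

text \<open>The row quotients give \<open>s\<close>, the column congruence gives \<open>t\<close>.
  Together with \<open>ext_pos_shift\<close>, cells of the block are exactly the classes modulo the
  lattice.\<close>

lemma ext_pos_eqD:
  assumes mn: "m \<ge> 1" "n \<ge> 1" and eq: "ext_pos m n k i j = ext_pos m n k i' j'"
  obtains s t where "i' = i + s * int m" "j' = j + s * int k + t * int n"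
proof -
  have nat_eq: "nat (x mod int l + 1) = nat (y mod int l + 1) \<longleftrightarrow> x mod int l = y mod int l" if "l \<ge> 1" for x y l
    using that by (simp add: eq_nat_nat_iff)
  have row: "(i - 1) mod int m = (i' - 1) mod int m"
    and col: "(j - int k * ((i - 1) div int m) - 1) mod int n = (j' - int k * ((i' - 1) div int m) - 1) mod int n"
    using eq nat_eq mn by (auto simp: ext_pos_def)
  define s where "s = (i' - 1) div int m - (i - 1) div int m"
  have "i' = i + s * int m"
    using div_mult_mod_eq[of "i - 1" "int m"] div_mult_mod_eq[of "i' - 1" "int m"] row
    unfolding s_def left_diff_distrib by linarith
  moreover have "int n dvd (j' - int k * ((i' - 1) div int m) - 1) - (j - int k * ((i - 1) div int m) - 1)"
    using col by (simp only: mod_eq_dvd_iff[symmetric])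
  then obtain t where "(j' - int k * ((i' - 1) div int m) - 1) - (j - int k * ((i - 1) div int m) - 1) = int n * t"
    by (rule dvdE)
  then have "j' = j + s * int k + t * int n" by (simp add: s_def algebra_simps)
  ultimately show ?thesis using that[of s t] by simp
qed

lemma small_multiple_zero:
  fixes s d x :: int
  assumes "x = s * d" "\<bar>x\<bar> < d"
  shows "s = 0"
proof (rule ccontr)
  assume "s \<noteq> 0"
  then have "1 * \<bar>d\<bar> \<le> \<bar>s\<bar> * \<bar>d\<bar>" by (intro mult_right_mono) auto
  moreover have "\<bar>x\<bar> = \<bar>s\<bar> * \<bar>d\<bar>" by (simp add: assms(1) abs_mult)
  ultimately show False using assms(2) abs_ge_self[of d] by linarith
qed

text \<open>After division by the gcd, n' divides a k' and is coprime to k'. This is why a column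
  closes up only after n' row periods, and hence why the tilde vectors have length m n'.\<close>

lemma dvd_of_gcd_relation:
  fixes n k :: nat and a b :: int
  assumes "n > 0" "a * int k = - b * int n"
  shows "int (n div gcd n k) dvd a"
proof -
  obtain g n' k' where g: "n = g * n'" "k = g * k'" "coprime n' k'" "g = gcd n k" "g > 0"
    using assms(1) div_gcd_coprime[of n k] gcd_dvd1[of n k] gcd_dvd2[of n k]
    by (metis dvd_mult_div_cancel gcd_pos_nat neq0_conv)
  have "int g * (a * int k') = int g * (- b * int n')"
    using assms(2) unfolding g(1,2) by (simp add: algebra_simps)
  then have "a * int k' = - b * int n'"
    using g(5) mult_cancel_left[of "int g" "a * int k'" "- b * int n'"] by simp
  then have "int n' dvd a * int k'" by simp
  then have "int n' dvd a"
    using g(3) by (simp add: coprime_dvd_mult_left_iff)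
  moreover have "n div gcd n k = n'" using g(1,5) unfolding g(4)[symmetric] by simp
  ultimately show ?thesis by simp
qed

lemma pi_map_eq:
  "pi_map m n k = coord_perm m n (\<lambda>(i, j). ext_pos m n k (int i + 1) (int j))"
  by (rule ext) (auto simp: pi_map_def coord_perm_def ext_eq restrict_def)

lemma tpi_map_eq:
  "tpi_map m n k = coord_perm m n (\<lambda>(i, j). ext_pos m n k (int i) (int j - 1))"
  by (rule ext) (auto simp: tpi_map_def coord_perm_def ext_eq restrict_def)

text \<open>A translation respects the lattice, and two block points in one class are less than a
  period apart, first in the rows and then in the columns.\<close>

lemma inj_on_ext_pos_shift:
  assumes mn: "m \<ge> 1" "n \<ge> 1"
  shows "inj_on (\<lambda>(i, j). ext_pos m n k (int i + a) (int j + b)) (block m n)"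
proof (rule inj_onI)
  fix c c' assume c: "c \<in> block m n" "c' \<in> block m n"
    and eq: "(\<lambda>(i, j). ext_pos m n k (int i + a) (int j + b)) c = (\<lambda>(i, j). ext_pos m n k (int i + a) (int j + b)) c'"
  obtain i j i' j' where ij: "c = (i, j)" "c' = (i', j')" by fastforce
  obtain s t where st: "int i' + a = int i + a + s * int m" "int j' + b = int j + b + s * int k + t * int n"
    using ext_pos_eqD[OF mn, of k "int i + a" "int j + b" "int i' + a" "int j' + b"] eq ij by auto
  have "s = 0"
    by (rule small_multiple_zero[of "int i' - int i" s "int m"]) (use st c ij in \<open>auto simp: block_def\<close>)
  moreover from this have "t = 0"
    by (intro small_multiple_zero[of "int j' - int j" t "int n"]) (use st c ij in \<open>auto simp: block_def\<close>)
  ultimately show "c = c'" using st ij by simp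
qed

section \<open>The generators preserve the spectral polynomial\<close>

abbreviation psi_coeff :: "nat \<Rightarrow> nat \<Rightarrow> nat \<Rightarrow> nat \<Rightarrow> nat \<Rightarrow> point \<Rightarrow> complex" where
  "psi_coeff m n k a b \<equiv> (\<lambda>q. coeff (coeff (psi m n k q) b) a)"

lemma coord_perm_generator:
  assumes mn: "m \<ge> 1" "n \<ge> 1"
    and F: "F = coord_perm m n (\<lambda>(i, j). ext_pos m n k (int i + a) (int j + b))"
    and \<Phi>: "\<And>q p. F q = Some p \<Longrightarrow> \<Phi> p = \<Phi> q"
  shows "preserves m n \<Phi> F \<and> preserves m n \<Phi> (inv\<^bsub>Bir m n\<^esub> F)"
proof -
  have pres: "preserves m n \<Phi> F"
    using \<Phi> by (auto simp: preserves_def F coord_perm_def phase_space_def split: if_splits)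
  moreover have "preserves m n \<Phi> (inv\<^bsub>Bir m n\<^esub> F)"
    unfolding F
  proof (rule inv_coord_perm[OF mn _ inj_on_ext_pos_shift[OF mn]])
    show "(\<lambda>(i, j). ext_pos m n k (int i + a) (int j + b)) \<in> block m n \<rightarrow> block m n"
      using ext_pos_in_block[OF mn] by auto
    show "preserves m n \<Phi> (coord_perm m n (\<lambda>(i, j). ext_pos m n k (int i + a) (int j + b)))"
      using pres by (simp add: F)
  qed
  ultimately show ?thesis ..
qed

lemma pi_map_preserves:
  assumes n: "n \<ge> 2" and m: "m \<ge> 1" and k: "k \<le> n"
  shows "preserves m n (psi_coeff m n k a b) (pi_map m n k) \<and>
    preserves m n (psi_coeff m n k a b) (inv\<^bsub>Bir m n\<^esub> (pi_map m n k))"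
proof (rule coord_perm_generator[where a = 1 and b = 0])
  fix q p assume qp: "pi_map m n k q = Some p"
  then have p: "p (i, j) = q (ext_pos m n k (int i + 1) (int j))" if "(i, j) \<in> block m n" for i j
    using that by (auto simp: pi_map_eq coord_perm_def split: if_splits)
  have "psi m n k p = psi m n k q"
  proof (rule psi_row_rotate[OF n m k])
    fix i j assume "i \<in> {1..<m}" "j \<in> {1..n}"
    then show "p (i, j) = q (i + 1, j)"
      using p[of i j] ext_pos_of_block[of "i + 1" j m n k] by (auto simp: block_def add.commute)
  next
    fix j assume j: "j \<in> {1..n}"
    let ?j = "if j \<le> k then j + n - k else j - k"
    have "ext_pos m n k (int m + 1) (int j) = ext_pos m n k (int 1) (int ?j)"
      using ext_pos_shift[OF m, of n k 1 1 "int ?j" "if j \<le> k then - 1 else 0"] k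
      by (auto simp: of_nat_diff add.commute)
    also have "\<dots> = (1, ?j)" by (rule ext_pos_of_block) (use j m k in \<open>auto simp: block_def\<close>)
    finally show "p (m, j) = q (1, ?j)" using p[of m j] j m by (simp add: block_def)
  qed
  then show "psi_coeff m n k a b p = psi_coeff m n k a b q" by simp
qed (use assms in \<open>simp_all add: pi_map_eq\<close>)

lemma tpi_map_preserves:
  assumes n: "n \<ge> 2" and m: "m \<ge> 1"
  shows "preserves m n (psi_coeff m n k a b) (tpi_map m n k) \<and>
    preserves m n (psi_coeff m n k a b) (inv\<^bsub>Bir m n\<^esub> (tpi_map m n k))"
proof (rule coord_perm_generator[where a = 0 and b = "-1"])
  fix q p assume qp: "tpi_map m n k q = Some p"
  then have p: "p (i, j) = q (ext_pos m n k (int i) (int j - 1))" if "(i, j) \<in> block m n" for i j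
    using that by (auto simp: tpi_map_eq coord_perm_def split: if_splits)
  have "psi m n k p = psi m n k q"
  proof (rule psi_column_rotate[OF n])
    fix i j assume ij: "i \<in> {1..m}" "j \<in> {1..n}"
    let ?j = "if j = 1 then n else j - 1"
    have "ext_pos m n k (int i) (int j - 1) = ext_pos m n k (int i) (int ?j)"
      using ext_pos_shift[OF m, of n k "int i" 0 "int ?j" "if j = 1 then - 1 else 0"] ij
      by (auto simp: of_nat_diff)
    also have "\<dots> = (i, ?j)" by (rule ext_pos_of_block) (use ij n in \<open>auto simp: block_def\<close>)
    finally show "p (i, j) = q (i, ?j)" using p[of i j] ij by (simp add: block_def)
  qed
  then show "psi_coeff m n k a b p = psi_coeff m n k a b q" by simp
qed (use assms in \<open>simp_all add: tpi_map_eq\<close>)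

lemma (in R_positions) swap_map_generator:
  assumes \<Phi>: "\<Phi> \<in> poly_fun m n" and inv: "\<And>q p. swap_map m n L u v q = Some p \<Longrightarrow> \<Phi> p = \<Phi> q"
  shows "preserves m n \<Phi> (rat_ext m n (swap_map m n L u v)) \<and>
    preserves m n \<Phi> (inv\<^bsub>Bir m n\<^esub> (rat_ext m n (swap_map m n L u v)))"
proof -
  have "preserves m n \<Phi> (swap_map m n L u v)"
    using inv by (auto simp: preserves_def swap_map_iff)
  from preserves_rat_ext[OF mn \<Phi> this] show ?thesis by (simp add: swap_map_inverse)
qed

lemma s_map_preserves:
  assumes n: "n \<ge> 2" and m: "m \<ge> 1" and r: "r \<in> {1..m - 1}"
  shows "preserves m n (psi_coeff m n k a b) (s_map m n r) \<and>
    preserves m n (psi_coeff m n k a b) (inv\<^bsub>Bir m n\<^esub> (s_map m n r))"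
proof -
  let ?u = "\<lambda>j. (r, j)" and ?v = "\<lambda>j. (r + 1, j)"
  interpret R_positions m n n ?u ?v
    by unfold_locales (use n m r in \<open>auto simp: block_def inj_on_def\<close>)
  have "s_formula m n r q = swap_map m n n ?u ?v q" for q
  proof (cases "q \<in> phase_space m n \<and> geom_R_defined n (\<lambda>j. q (?u j)) (\<lambda>j. q (?v j))")
    case True
    let ?p = "restrict (\<lambda>(i, j). if i = r then fst (R q) j else if i = r + 1 then snd (R q) j
            else q (i, j)) (block m n)"
    have "swap_map m n n ?u ?v q = Some ?p"
      unfolding swap_map_iff using True r by (auto simp: block_def phase_space_def)
    moreover have "s_formula m n r q = Some ?p"
      unfolding s_formula_def Let_def by (rule if_P[OF True])
    ultimately show ?thesis by (simp only:)
  next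
    case False
    then show ?thesis by (auto simp: s_formula_def swap_map_def Let_def)
  qed
  then have "s_formula m n r = swap_map m n n ?u ?v" by (rule ext)
  then have s: "s_map m n r = rat_ext m n (swap_map m n n ?u ?v)" by (simp only: s_map_def)
  show ?thesis
    unfolding s
  proof (rule swap_map_generator)
    show "psi_coeff m n k a b \<in> poly_fun m n"
      using poly_coeffs_psi[OF n] by (simp add: poly_coeffs_def)
    fix q p assume "swap_map m n n ?u ?v q = Some p"
    then have d: "geom_R_defined n (\<lambda>j. q (?u j)) (\<lambda>j. q (?v j))"
      and p: "\<And>j. j \<in> {1..n} \<Longrightarrow> p (r, j) = fst (R q) j" "\<And>j. j \<in> {1..n} \<Longrightarrow> p (r + 1, j) = snd (R q) j"
        "\<And>c. c \<in> block m n - ?u ` {1..n} - ?v ` {1..n} \<Longrightarrow> p c = q c"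
      unfolding swap_map_iff by auto
    have "psi m n k p = psi m n k q"
    proof (rule psi_row_swap[OF n r])
      fix j assume j: "j \<in> {1..n}"
      have j': "j mod n + 1 \<in> {1..n}" using mod_Suc_in n by simp
      show "p (r, j) * p (r + 1, j) = q (r, j) * q (r + 1, j)"
        unfolding p(1,2)[OF j] by (rule geom_R_prod[OF d j])
      show "p (r, j mod n + 1) + p (r + 1, j) = q (r, j mod n + 1) + q (r + 1, j)"
        unfolding p(1)[OF j'] p(2)[OF j] by (rule geom_R_sum[OF d j])
    next
      fix i j assume ij: "i \<in> {1..m}" "i \<noteq> r" "i \<noteq> r + 1" "j \<in> {1..n}"
      show "p (i, j) = q (i, j)" by (rule p(3)) (use ij in \<open>auto simp: block_def\<close>)
    qed
    then show "psi_coeff m n k a b p = psi_coeff m n k a b q" by simp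
  qed
qed

section \<open>The tilde coordinates and the column generators\<close>

locale tilde_rows =
  fixes m n k r :: nat
  assumes n: "n \<ge> 2" and m: "m \<ge> 1" and k: "k \<le> n" and r: "r \<in> {1..gcd n k - 1}"
begin

definition N :: nat where "N = gcd n k"

definition L :: nat where "L = m * (n div N)"

definition pos :: "nat \<Rightarrow> nat \<Rightarrow> nat \<times> nat" where
  "pos t l = ext_pos m n k (int m + 1 - int l) (int N + 1 - int t)"

lemma N_dvd: "N dvd n" "N dvd k" "int N dvd int n" "int N dvd int k" and N_ge: "N \<ge> 2"
  using r by (auto simp: N_def)

lemma L_eq: "N * L = m * n" and L_ge: "L \<ge> 1"
  using N_dvd(1) N_ge n m by (auto simp: L_def Suc_le_eq div_greater_zero_iff dvd_imp_le)

lemma tilde_eq: "tilde m n k q t l = q (pos t l)"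
  by (simp add: tilde_def ext_eq pos_def N_def)

text \<open>Lattice vectors have column part divisible by \<open>N\<close>, which recovers
  \<open>t\<close>. For equal \<open>t\<close>, the relation \<open>a * k + b * n = 0\<close> makes
  \<open>a\<close> a multiple of \<open>n div N\<close>, so \<open>l\<close> and \<open>l'\<close>
  agree modulo \<open>L\<close>.\<close>

lemma inj_on_pos: "inj_on (\<lambda>(t, l). pos t l) ({1..N} \<times> {1..L})"
proof (rule inj_onI, clarify)
  fix t l t' l' assume ran: "t \<in> {1..N}" "t' \<in> {1..N}" "l \<in> {1..L}" "l' \<in> {1..L}"
    and eq: "pos t l = pos t' l'"
  obtain a b where ab: "int m + 1 - int l' = int m + 1 - int l + a * int m"
    "int N + 1 - int t' = int N + 1 - int t + a * int k + b * int n"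
    using ext_pos_eqD[OF m _ eq[unfolded pos_def]] n by auto
  then have "int t - int t' = a * int k + b * int n" by simp
  then have "int N dvd int t - int t'" using N_dvd(3,4) by simp
  then obtain e where "int t - int t' = e * int N" by (metis dvdE mult.commute)
  moreover from this have "e = 0" by (rule small_multiple_zero) (use ran in auto)
  ultimately have tt: "t = t'" by simp
  with ab have z: "a * int k = - b * int n" by simp
  then have "int (n div N) dvd a"
    unfolding N_def by (rule dvd_of_gcd_relation[rotated]) (use n in simp)
  then obtain e where e: "a = int (n div N) * e" by (rule dvdE)
  have "int l - int l' = e * int L" using ab(1) e by (simp add: L_def algebra_simps)
  moreover from this have "e = 0" by (rule small_multiple_zero) (use ran in auto)
  ultimately show "t = t' \<and> l = l'" using tt by simp
qed

lemma pos_in_block: "pos t l \<in> block m n"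
  unfolding pos_def by (rule ext_pos_in_block) (use n m in auto)

text \<open>By counting: \<open>pos\<close> is injective and \<open>N * L = m * n\<close>.\<close>

lemma pos_surj:
  assumes "c \<in> block m n"
  obtains t l where "t \<in> {1..N}" "l \<in> {1..L}" "c = pos t l"
proof -
  have "card ((\<lambda>(t, l). pos t l) ` ({1..N} \<times> {1..L})) = card (block m n)"
    unfolding card_image[OF inj_on_pos] using L_eq by (simp add: block_def)
  then have "(\<lambda>(t, l). pos t l) ` ({1..N} \<times> {1..L}) = block m n"
    by (intro card_subset_eq finite_block) (auto simp: pos_in_block)
  then show ?thesis using assms that by force
qed

lemma pos_eq_iff:
  "t \<in> {1..N} \<Longrightarrow> t' \<in> {1..N} \<Longrightarrow> l \<in> {1..L} \<Longrightarrow> l' \<in> {1..L} \<Longrightarrow> pos t l = pos t' l' \<longleftrightarrow> t = t' \<and> l = l'"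
  using inj_onD[OF inj_on_pos, of "(t, l)" "(t', l')"] by auto

lemma rN: "r \<in> {1..N}" "r + 1 \<in> {1..N}"
  using r by (auto simp: N_def)

sublocale R_positions m n L "pos r" "pos (r + 1)"
proof unfold_locales
  show "inj_on (pos r) {1..L}" "inj_on (pos (r + 1)) {1..L}"
    using pos_eq_iff rN by (auto intro!: inj_onI)
  show "pos r ` {1..L} \<inter> pos (r + 1) ` {1..L} = {}"
  proof -
    have "pos r l \<noteq> pos (r + 1) l'" if "l \<in> {1..L}" "l' \<in> {1..L}" for l l'
      using pos_eq_iff[OF rN that] by simp
    then show ?thesis by blast
  qed
qed (use n m L_ge pos_in_block in auto)

text \<open>The \<open>THE\<close> in \<open>ts_formula\<close> denotes because the positions
  \<open>pos t l\<close> cover each cell of the block exactly once.\<close>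

lemma ts_formula_eq: "ts_formula m n k r = swap_map m n L (pos r) (pos (r + 1))"
proof
  fix q
  have tilde_fun: "tilde m n k q t = (\<lambda>l. q (pos t l))" for t by (simp add: tilde_eq fun_eq_iff)
  show "ts_formula m n k r q = swap_map m n L (pos r) (pos (r + 1)) q"
  proof (cases "q \<in> phase_space m n \<and> geom_R_defined L (\<lambda>l. q (pos r l)) (\<lambda>l. q (pos (r + 1) l))")
    case True
    then obtain p where p: "swap_map m n L (pos r) (pos (r + 1)) q = Some p"
      by (auto simp: swap_map_def Let_def)
    let ?P = "\<lambda>p. p \<in> phase_space m n \<and> (\<forall>t\<in>{1..N}. \<forall>l\<in>{1..L}.
               tilde m n k p t l = (if t = r then fst (R q) l else if t = r + 1 then snd (R q) l
                  else tilde m n k q t l))"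
    have "?P p"
    proof (intro conjI ballI)
      show "p \<in> phase_space m n" using p unfolding swap_map_iff by blast
      fix t l assume tl: "t \<in> {1..N}" "l \<in> {1..L}"
      have "pos t l \<in> block m n - pos r ` {1..L} - pos (r + 1) ` {1..L}" if "t \<noteq> r" "t \<noteq> r + 1"
        using pos_in_block pos_eq_iff[OF tl(1) rN(1) tl(2)] pos_eq_iff[OF tl(1) rN(2) tl(2)] that by blast
      then show "tilde m n k p t l = (if t = r then fst (R q) l else if t = r + 1 then snd (R q) l
                  else tilde m n k q t l)"
        using p tl(2) unfolding swap_map_iff tilde_eq by simp
    qed
    moreover have "p' = p" if p': "?P p'" for p'
    proof -
      have "p' c = p c" if "c \<in> block m n" for c
      proof -
        from that obtain t l where "t \<in> {1..N}" "l \<in> {1..L}" "c = pos t l" by (rule pos_surj)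
        then show ?thesis using p' \<open>?P p\<close> by (simp add: tilde_eq)
      qed
      then show ?thesis
        using p' \<open>?P p\<close> PiE_ext[of p' "block m n" "\<lambda>_. UNIV" p] unfolding phase_space_def by blast
    qed
    ultimately have "(THE p. ?P p) = p" by (rule the_equality)
    moreover have "ts_formula m n k r q = Some (THE p. ?P p)"
      unfolding ts_formula_def Let_def N_def[symmetric] L_def[symmetric] tilde_fun by (rule if_P[OF True])
    ultimately show ?thesis using p by (simp only:)
  next
    case False
    then show ?thesis
      by (auto simp: ts_formula_def swap_map_def Let_def N_def[symmetric] L_def[symmetric] tilde_fun)
  qed
qed

text \<open>Moving by \<open>L\<close> rows is \<open>n div N\<close> row periods, and the
  accompanying column shift \<open>(n div N) * k = n * (k div N)\<close> is a multiple of
  \<open>n\<close>.\<close>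

lemma ext_pos_mod_L:
  assumes "int L dvd x - y"
  shows "ext_pos m n k x c = ext_pos m n k y c"
proof -
  obtain d where "x - y = int L * d" using assms by (rule dvdE)
  then have x: "x = y + (d * int (n div N)) * int m" by (simp add: L_def algebra_simps)
  have "int (n div N) * int k = int n * int (k div N)"
    using N_dvd(1,2) by (metis dvd_div_mult dvd_div_mult_self mult.commute of_nat_mult div_mult_swap)
  then have c: "c = c + (d * int (n div N)) * int k + (- d * int (k div N)) * int n"
    by (simp add: algebra_simps)
  show ?thesis
    using ext_pos_shift[OF m, of n k y "d * int (n div N)" c "- d * int (k div N)"]
    unfolding x c[symmetric] by (simp only: c[symmetric])
qed

text \<open>The R-matrix acts on the columns \<open>j\<close> and \<open>j + 1\<close> of the extended array, for \<open>j\<close> in one residue class modulo \<open>N\<close>.\<close>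

definition upper_col :: "int \<Rightarrow> bool" where
  "upper_col j \<longleftrightarrow> int N dvd j - (int N - int r)"

text \<open>By Bezout a multiple of \<open>N\<close> is the column part of a lattice vector, so
  statements about column \<open>N - r\<close> in all rows transfer to its whole residue
  class.\<close>

lemma upper_colD:
  assumes "upper_col j"
  obtains s t where "j = int N - int r + s * int k + t * int n"
proof -
  from assms obtain e where e: "j - (int N - int r) = int N * e"
    unfolding upper_col_def by (rule dvdE)
  obtain u v where "u * int n + v * int k = gcd (int n) (int k)"
    using bezout_int by blast
  then have "int N = v * int k + u * int n" by (simp add: N_def)
  then have "int N * e = (v * e) * int k + (u * e) * int n" by (simp add: algebra_simps)
  with e show ?thesis using that[of "v * e" "u * e"] by simp
qed

context
  fixes q p assumes qp: "swap_map m n L (pos r) (pos (r + 1)) q = Some p"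
begin

text \<open>The index \<open>l\<close> of the tilde vectors runs against the rows, so
  \<open>l\<close> and \<open>l mod L + 1\<close> in \<open>geom_R_sum\<close> stand for row
  \<open>i + 1\<close> in the left column and row \<open>i\<close> in the right one.\<close>

lemma columns_row:
  "p (ext_pos m n k i (int N - int r)) * p (ext_pos m n k i (int N - int r + 1))
     = q (ext_pos m n k i (int N - int r)) * q (ext_pos m n k i (int N - int r + 1))"
  "p (ext_pos m n k i (int N - int r + 1)) + p (ext_pos m n k (i + 1) (int N - int r))
     = q (ext_pos m n k i (int N - int r + 1)) + q (ext_pos m n k (i + 1) (int N - int r))"
proof -
  have d: "geom_R_defined L (\<lambda>l. q (pos r l)) (\<lambda>l. q (pos (r + 1) l))"
    and p: "\<And>l. l \<in> {1..L} \<Longrightarrow> p (pos r l) = fst (R q) l" "\<And>l. l \<in> {1..L} \<Longrightarrow> p (pos (r + 1) l) = snd (R q) l"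
    using qp unfolding swap_map_iff by auto
  have pos: "pos r l = ext_pos m n k x (int N - int r + 1)" "pos (r + 1) l = ext_pos m n k x (int N - int r)"
    if "int L dvd int m + 1 - int l - x" for l x
    using ext_pos_mod_L[OF that] by (simp_all add: pos_def algebra_simps)
  \<comment> \<open>Rows matter only modulo \<open>L\<close>, so every integer row is reached by
    some index \<open>l\<close> of the vectors.\<close>
  have idx: "\<exists>l\<in>{1..L}. int L dvd int m + 1 - int l - x" for x
  proof -
    define l where "l = nat ((int m - x) mod int L) + 1"
    have b: "0 \<le> (int m - x) mod int L" "(int m - x) mod int L < int L" using L_ge by simp_all
    have "int l = (int m - x) mod int L + 1" using b by (simp add: l_def)
    then have "int m + 1 - int l - x = (int m - x) - (int m - x) mod int L" by simp
    then have "int L dvd int m + 1 - int l - x" by (simp add: minus_mod_eq_mult_div)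
    moreover have "l \<in> {1..L}" using b by (auto simp: l_def)
    ultimately show ?thesis by blast
  qed
  obtain l where l: "l \<in> {1..L}" "int L dvd int m + 1 - int l - i" using idx by blast
  show "p (ext_pos m n k i (int N - int r)) * p (ext_pos m n k i (int N - int r + 1))
     = q (ext_pos m n k i (int N - int r)) * q (ext_pos m n k i (int N - int r + 1))"
    unfolding pos[OF l(2), symmetric] p(1,2)[OF l(1)]
    using geom_R_prod[OF d l(1)] by (simp add: mult.commute)
  obtain l where l: "l \<in> {1..L}" "int L dvd int m + 1 - int l - (i + 1)" using idx by blast
  have l': "l mod L + 1 \<in> {1..L}" using mod_Suc_in[OF L_ge] .
  have "int L dvd int l - int l mod int L" by (simp add: minus_mod_eq_mult_div)
  then have "int L dvd (int m + 1 - int l - (i + 1)) + (int l - int l mod int L)" using l(2) by (rule dvd_add[rotated])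
  then have *: "int L dvd int m + 1 - int (l mod L + 1) - i" by (simp add: of_nat_mod algebra_simps)
  show "p (ext_pos m n k i (int N - int r + 1)) + p (ext_pos m n k (i + 1) (int N - int r))
     = q (ext_pos m n k i (int N - int r + 1)) + q (ext_pos m n k (i + 1) (int N - int r))"
    unfolding pos(1)[OF *, symmetric] pos(2)[OF l(2), symmetric] p(1)[OF l'] p(2)[OF l(1)]
    by (rule geom_R_sum[OF d l(1)])
qed

lemma columns_prod:
  assumes "upper_col j"
  shows "p (ext_pos m n k i j) * p (ext_pos m n k i (j + 1)) = q (ext_pos m n k i j) * q (ext_pos m n k i (j + 1))"
proof -
  from assms obtain s t where j: "j = int N - int r + s * int k + t * int n" by (rule upper_colD)
  show ?thesis
    using columns_row(1)[of "i - s * int m"]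
      ext_pos_shift[OF m, of n k "i - s * int m" s "int N - int r" t]
      ext_pos_shift[OF m, of n k "i - s * int m" s "int N - int r + 1" t]
    by (simp add: j algebra_simps)
qed

lemma columns_sum:
  assumes "upper_col j"
  shows "p (ext_pos m n k i (j + 1)) + p (ext_pos m n k (i + 1) j) = q (ext_pos m n k i (j + 1)) + q (ext_pos m n k (i + 1) j)"
proof -
  from assms obtain s t where j: "j = int N - int r + s * int k + t * int n" by (rule upper_colD)
  show ?thesis
    using columns_row(2)[of "i - s * int m"]
      ext_pos_shift[OF m, of n k "i + 1 - s * int m" s "int N - int r" t]
      ext_pos_shift[OF m, of n k "i - s * int m" s "int N - int r + 1" t]
    by (simp add: j algebra_simps)
qed

lemma columns_other:
  assumes "\<not> upper_col j" "\<not> upper_col (j - 1)"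
  shows "p (ext_pos m n k i j) = q (ext_pos m n k i j)"
proof -
  have ne: "ext_pos m n k i j \<noteq> ext_pos m n k x c" if "\<not> int N dvd j - c" for x c
  proof
    assume "ext_pos m n k i j = ext_pos m n k x c"
    then obtain s t where "c = j + s * int k + t * int n"
      using n by (auto elim: ext_pos_eqD[OF m, rotated])
    then have "j - c = - (s * int k + t * int n)" by simp
    then show False using that N_dvd(3,4) by simp
  qed
  have "ext_pos m n k i j \<noteq> pos r l" "ext_pos m n k i j \<noteq> pos (r + 1) l" for l
    unfolding pos_def using assms by (auto intro!: ne simp: upper_col_def algebra_simps)
  then have "ext_pos m n k i j \<in> block m n - pos r ` {1..L} - pos (r + 1) ` {1..L}"
    using ext_pos_in_block[OF m] n by auto
  then show ?thesis using qp unfolding swap_map_iff by blast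
qed

lemma psi_swap_columns: "psi m n k p = psi m n k q"
proof -
  define t where "t i j = (if upper_col (int j) then p (ext_pos m n k (int i) (int j)) - q (ext_pos m n k (int i) (int j)) else 0)" for i j
  have coord: "p (i, j) = p (ext_pos m n k (int i) (int j))" "q (i, j) = q (ext_pos m n k (int i) (int j))"
    if "i \<in> {1..m}" "j \<in> {1..n}" for i j
    using ext_pos_of_block[of i j m n k] that by (simp_all add: block_def)
  \<comment> \<open>Here \<open>N \<ge> 2\<close> enters: the exchanged pairs of columns do not
    overlap, so a column is a left partner, a right partner or neither.\<close>
  have step: "\<not> (upper_col j \<and> upper_col (j + 1))" for j
  proof
    assume "upper_col j \<and> upper_col (j + 1)"
    then have "int N dvd (j + 1 - (int N - int r)) - (j - (int N - int r))"
      unfolding upper_col_def by (intro dvd_diff[of "int N" "j + 1 - (int N - int r)"]) blast+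
    then show False using N_ge by simp
  qed
  have shift: "upper_col (j + x) \<longleftrightarrow> upper_col j" if "int N dvd x" for j x
    unfolding upper_col_def using dvd_add_left_iff[OF that, of "j - (int N - int r)"] by (simp add: algebra_simps)
  \<comment> \<open>Column 0 lies outside the class because \<open>1 \<le> r < N\<close>; by
    periodicity so does column \<open>n\<close>, and \<open>t\<close> vanishes at both ends.\<close>
  have col0: "\<not> upper_col 0"
  proof
    assume "upper_col 0"
    then have "int N dvd int r - int N" by (simp add: upper_col_def)
    then have "int N dvd int r" using dvd_add[OF _ dvd_refl[of "int N"]] by fastforce
    then show False using rN zdvd_not_zless[of "int r" "int N"] by auto
  qed
  show ?thesis
  proof (rule psi_shear[OF n k, where t = t])
    show "t i 0 = 0" for i using col0 by (simp add: t_def)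
    show "t i n = 0" for i using col0 shift[OF N_dvd(3), of 0] by (simp add: t_def)
  next
    fix i j assume i: "i \<in> {1..m}" and j: "j \<in> {1..n}"
    have j1: "int (j - 1) = int j - 1" using j by auto
    have t1: "t (i + 1) (j - 1) = (if upper_col (int j - 1)
        then p (ext_pos m n k (int i + 1) (int j - 1)) - q (ext_pos m n k (int i + 1) (int j - 1)) else 0)"
      by (simp only: t_def j1 of_nat_add of_nat_1)
    have t0: "t i j = (if upper_col (int j)
        then p (ext_pos m n k (int i) (int j)) - q (ext_pos m n k (int i) (int j)) else 0)"
      by (simp only: t_def)
    have "p (ext_pos m n k (int i) (int j)) + t (i + 1) (j - 1) = q (ext_pos m n k (int i) (int j)) + t i j"
    proof -
      consider "upper_col (int j)" "\<not> upper_col (int j - 1)" | "\<not> upper_col (int j)" "upper_col (int j - 1)"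
        | "\<not> upper_col (int j)" "\<not> upper_col (int j - 1)"
        using step[of "int j - 1"] by auto
      then show ?thesis
      proof cases
        case 1
        then show ?thesis unfolding t1 t0 by simp
      next
        case 2
        then show ?thesis using columns_sum[OF 2(2), of "int i"] unfolding t1 t0 by (simp add: algebra_simps)
      next
        case 3
        then show ?thesis using columns_other[OF 3] unfolding t1 t0 by simp
      qed
    qed
    then show "p (i, j) + t (i + 1) (j - 1) = q (i, j) + t i j" by (simp only: coord[OF i j])
  next
    fix i j assume i: "i \<in> {1..m}" and j: "j \<in> {1..<n}"
    then have "j \<in> {1..n}" "j + 1 \<in> {1..n}" by auto
    note c = coord(1)[OF i this(1)] coord(2)[OF i this(2)]
    show "p (i, j) * t (i + 1) j = t i j * q (i, j + 1)"
    proof (cases "upper_col (int j)")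
      case True
      let ?p = "\<lambda>i j. p (ext_pos m n k i j)" and ?q = "\<lambda>i j. q (ext_pos m n k i j)"
      \<comment> \<open>The sum identity gives a second expression for \<open>t (i + 1) j\<close>:
        the change of column \<open>j + 1\<close> in row \<open>i\<close>, with opposite sign. The
        claim then becomes the product identity.\<close>
      have "?p (int i + 1) (int j) - ?q (int i + 1) (int j) = ?q (int i) (int j + 1) - ?p (int i) (int j + 1)"
        using columns_sum[OF True, of "int i"] by (simp add: algebra_simps)
      moreover have "?p (int i) (int j) * (?q (int i) (int j + 1) - ?p (int i) (int j + 1))
          = (?p (int i) (int j) - ?q (int i) (int j)) * ?q (int i) (int j + 1)"
        using columns_prod[OF True, of "int i"] by (simp add: algebra_simps)
      ultimately show ?thesis unfolding c using True by (simp add: t_def add.commute)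
    qed (simp add: t_def)
  next
    fix j assume j: "j \<in> {1..n}"
    let ?j = "if j \<le> k then j + n - k else j - k"
    have jj: "int j = int ?j + 1 * int k + (if j \<le> k then - 1 else 0) * int n"
      using k by (auto simp: of_nat_diff)
    have "ext_pos m n k (int (m + 1)) (int j) = ext_pos m n k (int 1) (int ?j)"
      unfolding jj using ext_pos_shift[OF m, of n k 1 1 "int ?j" "if j \<le> k then - 1 else 0"]
      by (simp add: add.commute)
    moreover have "upper_col (int j) \<longleftrightarrow> upper_col (int ?j)"
      unfolding jj using shift[of "1 * int k + (if j \<le> k then - 1 else 0) * int n" "int ?j"] N_dvd(3,4)
      by (simp add: add.assoc)
    ultimately have "t (m + 1) j = t 1 ?j" by (simp only: t_def)
    then show "t (m + 1) j = (if j \<le> k then t 1 (j + n - k) else t 1 (j - k))" by simp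
  qed
qed

end

lemma ts_map_preserves:
  "preserves m n (psi_coeff m n k a b) (ts_map m n k r) \<and>
   preserves m n (psi_coeff m n k a b) (inv\<^bsub>Bir m n\<^esub> (ts_map m n k r))"
  unfolding ts_map_def ts_formula_eq
proof (rule swap_map_generator)
  show "psi_coeff m n k a b \<in> poly_fun m n"
    using poly_coeffs_psi[OF n] by (simp add: poly_coeffs_def)
qed (simp add: psi_swap_columns)

end

theorem corollary7p6:
  fixes n m k :: nat
  assumes "n \<ge> 2" and "m \<ge> 1" and "1 \<le> k" and "k \<le> n"
  shows "(\<forall>w\<in>carrier (W_grp m n k \<times>\<times> tW_grp m n k). \<forall>q\<in>phase_space m n. \<forall>p.
            act m n w q = Some p \<longrightarrow> psi m n k p = psi m n k q)
       \<and> (\<forall>a b. conserved_quantity m n k (\<lambda>q. coeff (coeff (psi m n k q) b) a))"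
proof -
  have mn: "m \<ge> 1" "n \<ge> 1" using assms by auto
  have main: "psi_coeff m n k a b p = psi_coeff m n k a b q"
    if w: "w \<in> carrier (W_grp m n k \<times>\<times> tW_grp m n k)" and act: "act m n w q = Some p" for w q p a b
  proof -
    have \<Phi>: "psi_coeff m n k a b \<in> poly_fun m n"
      using poly_coeffs_psi[OF assms(1)] by (simp add: poly_coeffs_def)
    have "fst w \<in> generate (Bir m n) (insert (pi_map m n k) (s_map m n ` {1..m - 1}))"
      using w by (auto simp: W_grp_def DirProd_def)
    then have 1: "preserves m n (psi_coeff m n k a b) (fst w)"
      by (rule generate_preserves[OF mn \<Phi>, rotated 2])
         (use pi_map_preserves[OF assms(1,2,4)] s_map_preserves[OF assms(1,2)] in blast)+
    have ts: "preserves m n (psi_coeff m n k a b) (ts_map m n k r) \<and>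
       preserves m n (psi_coeff m n k a b) (inv\<^bsub>Bir m n\<^esub> (ts_map m n k r))" if "r \<in> {1..gcd n k - 1}" for r
      by (rule tilde_rows.ts_map_preserves, unfold_locales) (use assms that in auto)
    have "snd w \<in> generate (Bir m n) (insert (tpi_map m n k) (ts_map m n k ` {1..gcd n k - 1}))"
      using w by (auto simp: tW_grp_def DirProd_def)
    then have 2: "preserves m n (psi_coeff m n k a b) (snd w)"
      by (rule generate_preserves[OF mn \<Phi>, rotated 2])
         (use tpi_map_preserves[OF assms(1,2)] ts in blast)+
    have "preserves m n (psi_coeff m n k a b) (act m n w)"
      using preserves_rat_ext[OF mn \<Phi> preserves_comp[OF 1 2]]
      by (simp add: act_def Bir_def units_of_def dominant_monoid_def)
    then show ?thesis using act by (simp add: preserves_def)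
  qed
  then have "psi m n k p = psi m n k q"
    if "w \<in> carrier (W_grp m n k \<times>\<times> tW_grp m n k)" "act m n w q = Some p" for w q p
    by (intro poly_eqI) (use that in blast)
  with main show ?thesis by (auto simp: conserved_quantity_def)
qed

end
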